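(* Let $Q\ge1$, $T>0$, $p\ge1$. Let $H_1,\dots,H_Q$ be time-independent Hermitian operators on a finite-dimensional Hilbert space, $\vec w=(w_1,\dots,w_Q)$ constant weights with $w_i\ge0$, $\sum_iw_i=1$, and $H=\sum_{i=1}^Qw_iH_i$. Put $\mathcal H=\sum_{i=1}^QH_i\otimes|i\rangle\langle i|$ and let $\lambda$ be a constant with $\lambda>2Q^{\frac{p-1}{p}}\|\mathcal H\|_\infty\|\vec w\|_p$. Let $E_T$ be the exact evolution channel for $H$ and $S_T$ the Markov-chain simulation channel with total transition rate $\lambda$. Then $$\|E_T-S_T\|_{p\to p}\le\frac{4\,Q^{\frac{p-1}{p}}\,\|\vec w\|_p\,\|\mathcal H-H\otimes\mathbb 1\|_\infty\,\|\mathcal H\|_\infty\,T}{\lambda-2Q^{\frac{p-1}{p}}\|\mathcal H\|_\infty\|\vec w\|_p}.$$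
   Context: For operators, $\|\cdot\|_p$ is the Schatten $p$-norm and $\|\cdot\|_\infty$ the operator norm; for vectors, $\|\vec w\|_p=(\sum_iw_i^p)^{1/p}$. $\|\Phi\|_{p\to p}:=\sup_{\|\rho\|_p\le1}\|\Phi(\rho)\|_p$, where $\rho$ ranges over (density) operators with $\|\rho\|_p\le1$. $\{|i\rangle\}_{i=1}^Q$ is the standard orthonormal basis of $\mathbb C^Q$. Exact channel: $E_T(\sigma)=e^{-iHT}\sigma e^{iHT}$. Simulation channel $S_T$: consider the continuous-time Markov chain on nodes $\{1,\dots,Q\}$ over $[0,T]$ with initial distribution $\vec w$ and transition rates from $i$ to $j\ne i$ given by $A_{ij}=\lambda w_j$, so that the chain is at node $i$ with probability $w_i$ at every time. While the chain is at node $i$, the quantum system evolves under $H_i$. $S_T$ is the channel mapping the initial state of the quantum system to its state at time $T$ averaged over trajectories of the chain. *)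

theory Defs
  imports "HOL-Probability.Probability"
begin

section \<open>Operators on a finite-dimensional Hilbert space\<close>

text \<open>Operators on the Hilbert space \<open>\<complex>\<^sup>n\<close> are matrices indexed by a finite type \<open>'n\<close>; the space
  tensored with \<open>\<complex>\<^sup>Q\<close> is indexed by \<open>'n \<times> 'q\<close>, where \<open>'q\<close> is the type of nodes.\<close>

type_synonym 'n cmat = "complex^'n^'n"

definition dagger :: "'n::finite cmat \<Rightarrow> 'n cmat" where
  "dagger A = transpose (map_matrix cnj A)"

definition hermitian :: "'n::finite cmat \<Rightarrow> bool" where
  "hermitian A \<longleftrightarrow> dagger A = A"

definition kron :: "'n::finite cmat \<Rightarrow> 'q::finite cmat \<Rightarrow> ('n \<times> 'q) cmat" where
  "kron A B = (\<chi> a b. A $ fst a $ fst b * B $ snd a $ snd b)"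

definition basis_proj :: "'q::finite \<Rightarrow> 'q cmat" where
  "basis_proj i = (\<chi> j k. if j = i \<and> k = i then 1 else 0)"

text \<open>The product of the type class instance for vectors is componentwise, so powers and
  the exponential of a matrix are spelled out with the matrix product.\<close>

primrec mat_power :: "'n::finite cmat \<Rightarrow> nat \<Rightarrow> 'n cmat" where
  "mat_power A 0 = mat 1"
| "mat_power A (Suc k) = A ** mat_power A k"

definition mat_exp :: "'n::finite cmat \<Rightarrow> 'n cmat" where
  "mat_exp A = (\<Sum>k. (1 / fact k) *\<^sub>R mat_power A k)"


section \<open>Norms\<close>

definition op_norm :: "'n::finite cmat \<Rightarrow> real" where
  "op_norm A = onorm (\<lambda>v. A *v v)"

text \<open>Multiplicity of \<open>s \<ge> 0\<close> as a singular value of \<open>A\<close>, i.e. as an eigenvalue of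
  \<open>(A\<^sup>\<dagger> A)\<^sup>1\<^sup>/\<^sup>2\<close>; it is \<open>0\<close> if \<open>s\<close> is not a singular value.\<close>

definition singular_mult :: "'n::finite cmat \<Rightarrow> real \<Rightarrow> nat" where
  "singular_mult A s = vec.dim {v. (dagger A ** A) *v v = complex_of_real (s\<^sup>2) *s v}"

definition schatten_norm :: "real \<Rightarrow> 'n::finite cmat \<Rightarrow> real" where
  "schatten_norm p A =
     (\<Sum>s | 0 \<le> s \<and> singular_mult A s \<noteq> 0. real (singular_mult A s) * s powr p) powr (1 / p)"

definition vec_pnorm :: "real \<Rightarrow> ('q::finite \<Rightarrow> real) \<Rightarrow> real" where
  "vec_pnorm p w = (\<Sum>i\<in>UNIV. w i powr p) powr (1 / p)"

definition induced_norm :: "real \<Rightarrow> ('n::finite cmat \<Rightarrow> 'n cmat) \<Rightarrow> real" where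
  "induced_norm p \<Phi> = (SUP \<rho>\<in>{\<rho>. schatten_norm p \<rho> \<le> 1}. schatten_norm p (\<Phi> \<rho>))"


section \<open>Hamiltonians and exact evolution\<close>

definition mean_hamiltonian :: "('q::finite \<Rightarrow> real) \<Rightarrow> ('q \<Rightarrow> 'n::finite cmat) \<Rightarrow> 'n cmat" where
  "mean_hamiltonian w H = (\<Sum>i\<in>UNIV. w i *\<^sub>R H i)"

definition block_hamiltonian :: "('q::finite \<Rightarrow> 'n::finite cmat) \<Rightarrow> ('n \<times> 'q) cmat" where
  "block_hamiltonian H = (\<Sum>i\<in>UNIV. kron (H i) (basis_proj i))"

definition evolution :: "'n::finite cmat \<Rightarrow> real \<Rightarrow> 'n cmat \<Rightarrow> 'n cmat" where
  "evolution H t \<sigma> =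
     mat_exp (map_matrix ((*) (- \<i> * of_real t)) H) ** \<sigma> ** mat_exp (map_matrix ((*) (\<i> * of_real t)) H)"


section \<open>Continuous-time Markov chains\<close>

text \<open>Right-continuous trajectories with finitely many jumps in \<open>[0, T]\<close>.\<close>

definition step_path :: "real \<Rightarrow> (real \<Rightarrow> 'q) \<Rightarrow> bool" where
  "step_path T x \<longleftrightarrow> (\<exists>(n::nat) t. t 0 = 0 \<and> t n = T \<and>
     (\<forall>k<n. t k < t (Suc k) \<and> (\<forall>r\<in>{t k..<t (Suc k)}. x r = x (t k))))"

text \<open>\<open>X\<close> is a time-homogeneous Markov chain over \<open>[0, T]\<close> with transition probabilities \<open>P\<close>:
  given the past, the conditional probability of being at \<open>j\<close> a time \<open>h\<close> after being at \<open>i\<close>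
  is \<open>P h i j\<close>.\<close>

definition markov_property ::
  "'m measure \<Rightarrow> real \<Rightarrow> (real \<Rightarrow> 'm \<Rightarrow> 'q::finite) \<Rightarrow> (real \<Rightarrow> 'q \<Rightarrow> 'q \<Rightarrow> real) \<Rightarrow> bool" where
  "markov_property M T X P \<longleftrightarrow>
     (\<forall>(n::nat) t i. 0 \<le> t 0 \<and> (\<forall>k\<le>n. t k < t (Suc k)) \<and> t (Suc n) \<le> T \<and>
        \<P>(\<omega> in M. \<forall>k\<le>n. X (t k) \<omega> = i k) > 0 \<longrightarrow>
        \<P>(\<omega> in M. X (t (Suc n)) \<omega> = i (Suc n) \<bar> \<forall>k\<le>n. X (t k) \<omega> = i k)
          = P (t (Suc n) - t n) (i n) (i (Suc n)))"

text \<open>Only the off-diagonal entries of the rate matrix \<open>A\<close> matter: for \<open>j \<noteq> i\<close>,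
  \<open>P h i j = A i j * h + o(h)\<close> as \<open>h\<close> tends to \<open>0\<close> from above; the probabilities \<open>P h i i\<close>
  are then determined to first order because each \<open>P h\<close> is a stochastic matrix.\<close>

definition markov_chain ::
  "'m measure \<Rightarrow> real \<Rightarrow> (real \<Rightarrow> 'm \<Rightarrow> 'q::finite) \<Rightarrow> ('q \<Rightarrow> real) \<Rightarrow> ('q \<Rightarrow> 'q \<Rightarrow> real) \<Rightarrow> bool" where
  "markov_chain M T X w A \<longleftrightarrow>
     prob_space M \<and>
     (\<forall>t\<in>{0..T}. X t \<in> measurable M (count_space UNIV)) \<and>
     (\<forall>\<omega>\<in>space M. step_path T (\<lambda>t. X t \<omega>)) \<and>
     (\<forall>i. \<P>(\<omega> in M. X 0 \<omega> = i) = w i) \<and>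
     (\<exists>P. (\<forall>h>0. \<forall>i. (\<forall>j. 0 \<le> P h i j) \<and> (\<Sum>j\<in>UNIV. P h i j) = 1) \<and>
          markov_property M T X P \<and>
          (\<forall>i j. i \<noteq> j \<longrightarrow> ((\<lambda>h. P h i j / h) \<longlongrightarrow> A i j) (at_right 0)))"


section \<open>The simulation channel\<close>

text \<open>\<open>traj_state H x \<sigma> t \<rho>\<close>: a system started in \<open>\<sigma>\<close> at time \<open>0\<close>, which evolves under \<open>H i\<close>
  while the trajectory \<open>x\<close> is at node \<open>i\<close>, is in state \<open>\<rho>\<close> at time \<open>t\<close>. Different subdivisions
  of \<open>[0, t]\<close> into intervals of constancy lead to the same \<open>\<rho>\<close>, so for a step path there is
  exactly one such \<open>\<rho>\<close>.\<close>

inductive traj_state ::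
  "('q \<Rightarrow> 'n::finite cmat) \<Rightarrow> (real \<Rightarrow> 'q) \<Rightarrow> 'n cmat \<Rightarrow> real \<Rightarrow> 'n cmat \<Rightarrow> bool"
  for H :: "'q \<Rightarrow> 'n cmat" and x :: "real \<Rightarrow> 'q" and \<sigma> :: "'n cmat" where
  start: "traj_state H x \<sigma> 0 \<sigma>"
| evolve: "traj_state H x \<sigma> s \<rho> \<Longrightarrow> s < t \<Longrightarrow> (\<forall>r\<in>{s..<t}. x r = i) \<Longrightarrow>
    traj_state H x \<sigma> t (evolution (H i) (t - s) \<rho>)"

definition simulation ::
  "'m measure \<Rightarrow> (real \<Rightarrow> 'm \<Rightarrow> 'q) \<Rightarrow> ('q \<Rightarrow> 'n::finite cmat) \<Rightarrow> real \<Rightarrow> 'n cmat \<Rightarrow> 'n cmat" where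
  "simulation M X H T \<sigma> = (LINT \<omega>|M. (THE \<rho>. traj_state H (\<lambda>t. X t \<omega>) \<sigma> T \<rho>))"

end

theory Submission
  imports Defs
begin

text \<open>Sample the chain at the times \<open>k h\<close> with \<open>h = T/N\<close>, and let \<open>\<sigma>\<^sub>j\<close> be the unnormalised state of the
  system on the event that the chain is at node \<open>j\<close>. By the Markov property
  \<open>\<sigma>'\<^sub>j = \<Sum>\<^sub>i P h i j U\<^sub>i(\<sigma>\<^sub>i)\<close>, where \<open>U\<^sub>i\<close> is the evolution under \<open>H\<^sub>i\<close> for time \<open>h\<close>. Put
  \<open>\<rho> = \<Sum>\<^sub>j \<sigma>\<^sub>j\<close> and \<open>D = \<Sum>\<^sub>j \<parallel>\<sigma>\<^sub>j - w\<^sub>j \<rho>\<parallel>\<^sub>p\<close>. Since \<open>\<parallel>[A, \<sigma>]\<parallel>\<^sub>p \<le> 2 \<parallel>A\<parallel> \<parallel>\<sigma>\<parallel>\<^sub>p\<close>, one step gives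
  \<open>D' \<le> (1 - (\<lambda> - 2\<eta>) h) D + 2 \<Delta> h + o(h)\<close> with \<open>\<eta> = max \<parallel>H\<^sub>i\<parallel>\<close> and \<open>\<Delta> = max \<parallel>H\<^sub>i - H\<parallel>\<close>, so that \<open>D\<close> stays
  below \<open>2\<Delta> / (\<lambda> - 2\<eta>) + o(1)\<close>, while the error of \<open>\<rho>\<close> against the exact evolution grows by at most
  \<open>2 \<eta> h D + o(h)\<close> per step. Letting \<open>N\<close> tend to infinity yields the bound \<open>4 \<eta> \<Delta> T / (\<lambda> - 2\<eta>)\<close>. It implies the
  theorem because \<open>Q powr ((p - 1) / p) * \<parallel>w\<parallel>\<^sub>p \<ge> 1\<close> by the power mean inequality.\<close>

subsection \<open>Complex matrices\<close>

text \<open>The chain is given only by conditional probabilities at finitely many times and by its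
  off-diagonal rates, so there is no master equation to differentiate. Sampling turns expectations
  into finite sums over node histories, and step paths bring the limit back trajectory by
  trajectory. The rates \<open>lam * w j\<close> do not depend on the node that is left. To first
  order in \<open>h\<close> a step therefore keeps the node with weight \<open>1 - lam * h\<close>
  and otherwise draws it anew from \<open>w\<close>. A redraw makes node and system independent,
  whence the contraction rate \<open>lam\<close>; the deviations also shift the centre of the
  comparison, by at most about \<open>2 * eta * h\<close> times their size, which leaves
  \<open>lam - 2 * eta\<close>. The disagreement of \<open>H i\<close> with the mean is the source
  \<open>2 * Delta\<close>. The deviation starts at 0, since the initial node is drawn independently
  of the state, and it acts on the total state only through \<open>U i - id\<close>, because
  deviations sum to zero. All Schatten norm inequalities rest on one variational fact: among the
  diagonals of \<open>A ** X ** B\<close> with contractions \<open>A\<close>, \<open>B\<close>, the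
  singular values have the largest p-norm.\<close>

definition cdot :: "complex^'n::finite \<Rightarrow> complex^'n \<Rightarrow> complex" where
  "cdot x y = (\<Sum>i\<in>UNIV. cnj (x $ i) * y $ i)"

definition diag :: "('n::finite \<Rightarrow> complex) \<Rightarrow> 'n cmat" where
  "diag d = (\<chi> i j. if i = j then d i else 0)"

lemma norm_sq_cvec: "(norm (x::complex^'n::finite))\<^sup>2 = (\<Sum>i\<in>UNIV. (cmod (x $ i))\<^sup>2)"
  by (simp add: norm_vec_def L2_set_def sum_nonneg)

lemma cdot_self: "cdot x x = of_real ((norm x)\<^sup>2)"
  unfolding norm_sq_cvec cdot_def of_real_sum
  by (rule sum.cong) (auto simp: complex_norm_square mult.commute simp del: of_real_power)

text \<open>The real inner product serves to maximise the Rayleigh quotient, the complex one to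
  express orthogonality over the complex field; this is the bridge.\<close>

lemma inner_eq_cdot: "x \<bullet> y = Re (cdot x y)"
  by (simp add: inner_vec_def cdot_def inner_complex_def)

lemma cnj_cdot: "cnj (cdot x y) = cdot y x"
  by (simp add: cdot_def mult.commute)

lemma cdot_add_right: "cdot x (y + z) = cdot x y + cdot x z"
  by (simp add: cdot_def algebra_simps sum.distrib)

lemma cdot_diff_right: "cdot x (y - z) = cdot x y - cdot x z"
  by (simp add: cdot_def algebra_simps sum_subtractf)

lemma cdot_scale_right: "cdot x (c *s y) = c * cdot x y"
  by (simp add: cdot_def sum_distrib_left algebra_simps)

lemma cdot_scale_left: "cdot (c *s x) y = cnj c * cdot x y"
  by (simp add: cdot_def sum_distrib_left algebra_simps)

lemma cdot_zero_right [simp]: "cdot x 0 = 0"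
  by (simp add: cdot_def)

lemma cdot_sum_right: "cdot x (\<Sum>i\<in>I. f i) = (\<Sum>i\<in>I. cdot x (f i))"
  by (induction I rule: infinite_finite_induct) (auto simp: cdot_add_right)

lemma norm_cdot_le: "cmod (cdot x y) \<le> norm x * norm y"
proof -
  have "cmod (cdot x y) \<le> (\<Sum>i\<in>UNIV. cmod (x $ i) * cmod (y $ i))"
    unfolding cdot_def by (rule order_trans[OF norm_sum]) (simp add: norm_mult)
  also have "\<dots> \<le> L2_set (\<lambda>i. cmod (x $ i)) UNIV * L2_set (\<lambda>i. cmod (y $ i)) UNIV"
    using L2_set_mult_ineq[of "\<lambda>i. cmod (x $ i)" "\<lambda>i. cmod (y $ i)" UNIV] by simp
  finally show ?thesis by (simp add: norm_vec_def)
qed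

lemma dagger_nth: "dagger A $ i $ j = cnj (A $ j $ i)"
  by (simp add: dagger_def transpose_def)

lemma dagger_dagger [simp]: "dagger (dagger A) = A"
  by (simp add: vec_eq_iff dagger_nth)

lemma dagger_mult: "dagger (A ** B) = dagger B ** dagger A"
  by (simp add: vec_eq_iff dagger_nth matrix_matrix_mult_def mult.commute)

lemma dagger_diag: "dagger (diag d) = diag (\<lambda>i. cnj (d i))"
  by (auto simp: vec_eq_iff dagger_nth diag_def)

lemma cdot_matrix_left: "cdot (A *v x) y = cdot x (dagger A *v y)"
proof -
  have "cdot (A *v x) y = (\<Sum>i\<in>UNIV. \<Sum>j\<in>UNIV. cnj (A $ i $ j) * cnj (x $ j) * y $ i)"
    by (simp add: cdot_def matrix_vector_mult_def sum_distrib_right)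
  also have "\<dots> = (\<Sum>j\<in>UNIV. \<Sum>i\<in>UNIV. cnj (A $ i $ j) * cnj (x $ j) * y $ i)"
    by (rule sum.swap)
  also have "\<dots> = cdot x (dagger A *v y)"
    by (simp add: cdot_def matrix_vector_mult_def dagger_nth sum_distrib_left algebra_simps)
  finally show ?thesis .
qed

lemma scaleR_eq_vector_scale: "r *\<^sub>R (x::complex^'n) = of_real r *s x"
  by (simp add: vec_eq_iff) (simp add: scaleR_conv_of_real)

lemma diag_mult: "diag a ** diag b = diag (\<lambda>i. a i * b i)"
  by (auto simp: vec_eq_iff diag_def matrix_matrix_mult_def if_distrib[of "\<lambda>x. x * _"]
      sum.delta' cong: if_cong)

lemma diag_mult_vec: "(diag a *v x) $ i = a i * x $ i"
  by (simp add: diag_def matrix_vector_mult_def if_distrib[of "\<lambda>x. x * _"] cong: if_cong)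

lemma mult_diag_nth: "(A ** diag a) $ i $ j = A $ i $ j * a j"
  by (simp add: diag_def matrix_matrix_mult_def if_distrib[of "\<lambda>x. _ * x"] cong: if_cong)

lemma mult_axis_nth: "(A *v axis j 1) $ i = A $ i $ j"
  by (simp add: matrix_vector_mult_def axis_def if_distrib[of "\<lambda>x. _ * x"] cong: if_cong)


lemma matrix_vector_scaleR_right: "A *v (r *\<^sub>R x) = r *\<^sub>R (A *v (x::complex^'n))"
  by (rule linear_scale[OF matrix_vector_mul_linear])

subsection \<open>Spectral theorem\<close>

text \<open>A maximiser of the Rayleigh quotient on the compact unit sphere of \<open>S\<close> is
  an eigenvector. Invariance of \<open>S\<close> keeps the residual of the eigenvalue equation
  inside \<open>S\<close>, so it is an admissible direction of variation.\<close>

lemma hermitian_eigenvector_in_subspace: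
  fixes B :: "'n::finite cmat"
  assumes B: "hermitian B" and S: "vec.subspace S" and nz: "\<exists>x\<in>S. x \<noteq> 0"
    and inv: "\<And>x. x \<in> S \<Longrightarrow> B *v x \<in> S"
  shows "\<exists>x\<in>S. norm x = 1 \<and> (\<exists>\<mu>. B *v x = of_real \<mu> *s x)"
proof -
  have Sr: "subspace S"
    using S unfolding vec.subspace_def subspace_def scaleR_eq_vector_scale by blast
  have sym: "x \<bullet> (B *v y) = (B *v x) \<bullet> y" for x y
    using B by (simp add: inner_eq_cdot cdot_matrix_left hermitian_def)
  define f where "f x = x \<bullet> (B *v x)" for x
  have "compact (S \<inter> sphere 0 1)"
    by (intro closed_Int_compact closed_subspace Sr) auto
  moreover have "S \<inter> sphere 0 1 \<noteq> {}"
  proof -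
    obtain x where "x \<in> S" "x \<noteq> 0" using nz by blast
    then have "(1 / norm x) *\<^sub>R x \<in> S \<inter> sphere 0 1"
      using subspace_scale[OF Sr] by auto
    then show ?thesis by blast
  qed
  moreover have "continuous_on (S \<inter> sphere 0 1) f"
    unfolding f_def
    by (intro continuous_intros linear_continuous_on matrix_vector_mul_bounded_linear)
  ultimately obtain x where x0: "x \<in> S \<inter> sphere 0 1" and max0: "\<forall>y\<in>S \<inter> sphere 0 1. f y \<le> f x"
    using continuous_attains_sup[of "S \<inter> sphere 0 1" f] by blast
  then have x: "x \<in> S" "norm x = 1"
    and max: "\<And>y. y \<in> S \<Longrightarrow> norm y = 1 \<Longrightarrow> f y \<le> f x"
    by auto
  define \<mu> where "\<mu> = f x"
  have le: "f y \<le> \<mu> * (norm y)\<^sup>2" if "y \<in> S" for y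
  proof (cases "y = 0")
    case False
    have "f ((1 / norm y) *\<^sub>R y) \<le> \<mu>"
      using max[of "(1 / norm y) *\<^sub>R y"] subspace_scale[OF Sr that] False by (simp add: \<mu>_def)
    moreover have "f ((1 / norm y) *\<^sub>R y) = f y / (norm y)\<^sup>2"
      by (simp add: f_def matrix_vector_scaleR_right power2_eq_square)
    ultimately show ?thesis using False by (simp add: field_simps)
  qed (simp add: f_def)
  define y where "y = B *v x - \<mu> *\<^sub>R x"
  have yS: "y \<in> S"
    unfolding y_def using inv x Sr by (auto intro: subspace_diff subspace_scale)
  define c where "c = \<mu> * (norm y)\<^sup>2 - f y"
  \<comment> \<open>Compares the maximum with the perturbed vector \<open>x + t *\<^sub>R y\<close>.
    The constant terms cancel, and the linear term is \<open>2 * t * (norm y)\<^sup>2\<close>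
    because \<open>y\<close> is the residual itself.\<close>
  have g: "2 * t * (norm y)\<^sup>2 \<le> t\<^sup>2 * c" for t
  proof -
    have g1: "f (x + t *\<^sub>R y) \<le> \<mu> * (norm (x + t *\<^sub>R y))\<^sup>2"
      using le[of "x + t *\<^sub>R y"] x yS Sr by (auto intro: subspace_add subspace_scale)
    have g2: "f (x + t *\<^sub>R y) = \<mu> + 2 * t * ((B *v x) \<bullet> y) + t\<^sup>2 * f y"
      using sym[of x y] by (simp add: f_def \<mu>_def matrix_vector_scaleR_right algebra_simps
          inner_add_left inner_add_right power2_eq_square inner_commute)
    have g3: "(norm (x + t *\<^sub>R y))\<^sup>2 = 1 + 2 * t * (x \<bullet> y) + t\<^sup>2 * (norm y)\<^sup>2"
      unfolding power2_norm_eq_inner using x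
      by (simp add: inner_add_left inner_add_right algebra_simps inner_commute power2_eq_square norm_eq_1)
    have "(norm y)\<^sup>2 = (B *v x) \<bullet> y - \<mu> * (x \<bullet> y)"
      unfolding power2_norm_eq_inner by (subst (1) y_def) (simp add: inner_diff_left)
    then have g4: "(B *v x) \<bullet> y = (norm y)\<^sup>2 + \<mu> * (x \<bullet> y)" by simp
    show ?thesis
      using g1 unfolding g2 g3 g4 by (simp add: c_def algebra_simps)
  qed
  have "y = 0"
  proof (rule ccontr)
    assume "y \<noteq> 0"
    then have a: "(norm y)\<^sup>2 > 0" by simp
    \<comment> \<open>Small enough that \<open>t * c\<close> is at most
      \<open>(norm y)\<^sup>2\<close>, which contradicts \<open>g\<close>; the summand 1 keeps the
      denominator positive.\<close>
    define t where "t = (norm y)\<^sup>2 / (\<bar>c\<bar> + 1)"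
    have t: "t > 0" using a by (auto simp: t_def intro!: divide_pos_pos)
    have "t * (2 * (norm y)\<^sup>2) \<le> t * (t * c)" using g[of t] by (simp add: power2_eq_square mult_ac)
    then have "2 * (norm y)\<^sup>2 \<le> t * c" using t by (simp only: mult_le_cancel_left_pos)
    also have "\<dots> \<le> t * (\<bar>c\<bar> + 1)" using t by (intro mult_left_mono) auto
    also have "\<dots> = (norm y)\<^sup>2" by (simp add: t_def add_nonneg_eq_0_iff)
    finally show False using a by simp
  qed
  then have "B *v x = of_real \<mu> *s x" by (simp add: y_def scaleR_eq_vector_scale)
  then show ?thesis using x by blast
qed

lemma orthonormal_independent:
  fixes E :: "(complex^'n::finite) set"
  assumes fin: "finite E" and one: "\<And>x. x \<in> E \<Longrightarrow> norm x = 1"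
    and orth: "\<And>x y. x \<in> E \<Longrightarrow> y \<in> E \<Longrightarrow> x \<noteq> y \<Longrightarrow> cdot x y = 0"
  shows "vec.independent E"
proof (rule vec.independent_if_scalars_zero[OF fin])
  fix f x assume z: "(\<Sum>x\<in>E. f x *s x) = 0" and x: "x \<in> E"
  have "0 = cdot x (\<Sum>y\<in>E. f y *s y)" using z by simp
  also have "\<dots> = (\<Sum>y\<in>E. if y = x then f y else 0)"
    unfolding cdot_sum_right cdot_scale_right
    by (rule sum.cong) (use orth x one in \<open>auto simp: cdot_self\<close>)
  finally show "f x = 0" using x fin by simp
qed

text \<open>Takes an orthonormal set of eigenvectors of largest cardinality. Its orthogonal
  complement is invariant under \<open>B\<close>, so a nonzero complement would contain a further
  eigenvector; hence the set spans.\<close>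

lemma hermitian_orthonormal_eigenbasis:
  fixes B :: "'n::finite cmat"
  assumes B: "hermitian B"
  obtains u :: "'n \<Rightarrow> complex^'n" and \<mu> :: "'n \<Rightarrow> real" where
    "\<And>i j. cdot (u i) (u j) = (if i = j then 1 else 0)"
    "\<And>i. B *v u i = of_real (\<mu> i) *s u i"
proof -
  define P where "P E \<longleftrightarrow> finite E \<and> (\<forall>x\<in>E. norm x = 1 \<and> (\<exists>\<mu>::real. B *v x = of_real \<mu> *s x)) \<and>
    (\<forall>x\<in>E. \<forall>y\<in>E. x \<noteq> y \<longrightarrow> cdot x y = 0)" for E
  have ind: "vec.independent E" if "P E" for E
    using that unfolding P_def by (intro orthonormal_independent) auto
  have "P {}" by (simp add: P_def)
  moreover have "\<forall>E. P E \<longrightarrow> card E \<le> CARD('n)"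
  proof (intro allI impI)
    fix E assume "P E"
    then have "card E = vec.dim E" using vec.dim_eq_card_independent[OF ind] by simp
    also have "\<dots> \<le> vec.dim (UNIV :: (complex^'n) set)" by (rule vec.dim_subset) simp
    finally show "card E \<le> CARD('n)" by (simp only: vec_dim_card)
  qed
  ultimately have "\<exists>E. P E \<and> (\<forall>F. P F \<longrightarrow> card F \<le> card E)"
    using ex_has_greatest_nat[of P "{}" card "Suc CARD('n)"] by (simp add: less_Suc_eq_le)
  then obtain E where E: "P E" and Emax: "\<And>F. P F \<Longrightarrow> card F \<le> card E" by blast
  define S where "S = {x. \<forall>e\<in>E. cdot e x = 0}"
  have S: "vec.subspace S"
    by (auto simp: S_def vec.subspace_def cdot_add_right cdot_scale_right)
  have inv: "B *v x \<in> S" if "x \<in> S" for x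
  proof -
    have "cdot e (B *v x) = 0" if e: "e \<in> E" for e
    proof -
      obtain \<mu> :: real where "B *v e = of_real \<mu> *s e" using E e unfolding P_def by blast
      moreover have "cdot e (B *v x) = cdot (B *v e) x"
        using B by (simp add: cdot_matrix_left hermitian_def)
      ultimately show ?thesis using \<open>x \<in> S\<close> e by (simp add: cdot_scale_left S_def)
    qed
    then show ?thesis by (simp add: S_def)
  qed
  have S0: "x = 0" if "x \<in> S" for x
  proof (rule ccontr)
    assume "x \<noteq> 0"
    then have "\<exists>x\<in>S. x \<noteq> 0" using that by blast
    then obtain z where z: "z \<in> S" "norm z = 1" "\<exists>\<mu>::real. B *v z = of_real \<mu> *s z"
      using hermitian_eigenvector_in_subspace[OF B S _ inv] by metis
    have zE: "z \<notin> E" using z by (auto simp: S_def cdot_self)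
    have "cdot z e = 0" if "e \<in> E" for e
      using z that cnj_cdot[of e z] by (simp add: S_def)
    then have "P (insert z E)"
      using E z by (auto simp: P_def S_def)
    then have "card (insert z E) \<le> card E" by (rule Emax)
    then show False using zE E by (simp add: P_def)
  qed
  have span: "vec.span E = UNIV"
  proof -
    have "x \<in> vec.span E" for x
    proof -
      have "x - (\<Sum>e\<in>E. cdot e x *s e) \<in> S"
      proof -
        have "cdot d (x - (\<Sum>e\<in>E. cdot e x *s e)) = 0" if d: "d \<in> E" for d
        proof -
          have "(\<Sum>e\<in>E. cdot e x * cdot d e) = (\<Sum>e\<in>E. if e = d then cdot d x else 0)"
            by (rule sum.cong) (use E d in \<open>auto simp: P_def cdot_self\<close>)
          then show ?thesis
            using E d by (simp add: cdot_diff_right cdot_sum_right cdot_scale_right P_def)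
        qed
        then show ?thesis by (simp add: S_def)
      qed
      then have "x = (\<Sum>e\<in>E. cdot e x *s e)" using S0 by force
      then show ?thesis
        by (metis (no_types, lifting) vec.span_base vec.span_scale vec.span_sum)
    qed
    then show ?thesis by blast
  qed
  have "card E = CARD('n)"
    using vec.basis_card_eq_dim[of E UNIV] span ind[OF E] vec_dim_card by auto
  moreover have "finite E" using E by (simp add: P_def)
  ultimately obtain u where u: "bij_betw u (UNIV::'n set) E"
    using finite_same_card_bij[of "UNIV::'n set" E] by auto
  have uE: "u i \<in> E" for i using u by (auto simp: bij_betw_def)
  have "\<forall>i. \<exists>\<mu>::real. B *v u i = of_real \<mu> *s u i" using E uE unfolding P_def by blast
  then obtain \<mu> :: "'n \<Rightarrow> real" where "\<And>i. B *v u i = of_real (\<mu> i) *s u i" by metis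
  moreover have "cdot (u i) (u j) = (if i = j then 1 else 0)" for i j
    using E uE u by (auto simp: P_def cdot_self bij_betw_def inj_eq)
  ultimately show thesis using that by blast
qed

definition unitary :: "'n::finite cmat \<Rightarrow> bool" where
  "unitary U \<longleftrightarrow> dagger U ** U = mat 1 \<and> U ** dagger U = mat 1"

lemma spectral_theorem:
  fixes B :: "'n::finite cmat"
  assumes "hermitian B"
  obtains U and \<mu> :: "'n \<Rightarrow> real" where "unitary U" "B = U ** diag (\<lambda>i. of_real (\<mu> i)) ** dagger U"
proof -
  obtain u :: "'n \<Rightarrow> complex^'n" and \<mu> where
    u: "\<And>i j. cdot (u i) (u j) = (if i = j then 1 else 0)"
    and ev: "\<And>i. B *v u i = of_real (\<mu> i) *s u i"
    using hermitian_orthonormal_eigenbasis[OF assms] by blast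
  define U where "U = (\<chi> i j. u j $ i)"
  have "dagger U ** U = mat 1"
    by (simp add: vec_eq_iff matrix_matrix_mult_def dagger_nth U_def mat_def cdot_def[symmetric] u)
  then have U: "unitary U"
    by (simp add: unitary_def matrix_left_right_inverse)
  have "(B ** U) $ i $ j = (B *v u j) $ i" for i j
    by (simp add: matrix_matrix_mult_def matrix_vector_mult_def U_def)
  then have "B ** U = U ** diag (\<lambda>i. of_real (\<mu> i))"
    by (simp add: vec_eq_iff mult_diag_nth ev U_def mult.commute)
  then have "B ** U ** dagger U = U ** diag (\<lambda>i. of_real (\<mu> i)) ** dagger U" by simp
  then have "B = U ** diag (\<lambda>i. of_real (\<mu> i)) ** dagger U"
    using U by (simp add: unitary_def matrix_mul_assoc[symmetric])
  then show thesis using U that by blast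
qed


subsection \<open>The operator norm\<close>

lemma norm_matrix_vector_le: "norm (A *v x) \<le> op_norm A * norm x"
  unfolding op_norm_def by (rule onorm[OF matrix_vector_mul_bounded_linear])

lemma op_norm_nonneg: "0 \<le> op_norm A"
  unfolding op_norm_def by (rule onorm_pos_le[OF matrix_vector_mul_bounded_linear])

lemma op_norm_leI: "0 \<le> b \<Longrightarrow> (\<And>x. norm (A *v x) \<le> b * norm x) \<Longrightarrow> op_norm A \<le> b"
  unfolding op_norm_def by (rule onorm_bound)

lemma op_norm_mult: "op_norm (A ** B) \<le> op_norm A * op_norm B"
proof (rule op_norm_leI)
  fix x
  have "norm ((A ** B) *v x) \<le> op_norm A * norm (B *v x)"
    unfolding matrix_vector_mul_assoc[symmetric] by (rule norm_matrix_vector_le)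
  also have "\<dots> \<le> op_norm A * (op_norm B * norm x)"
    by (intro mult_left_mono norm_matrix_vector_le op_norm_nonneg)
  finally show "norm ((A ** B) *v x) \<le> op_norm A * op_norm B * norm x" by simp
qed (simp add: op_norm_nonneg)

lemma op_norm_contraction_mult:
  "op_norm A \<le> a \<Longrightarrow> op_norm B \<le> b \<Longrightarrow> op_norm (A ** B) \<le> a * b"
  by (rule order_trans[OF op_norm_mult])
    (auto intro!: mult_mono op_norm_nonneg intro: order_trans[OF op_norm_nonneg])

text \<open>Moves one \<open>dagger A\<close> across \<open>cdot\<close> in the squared norm of
  \<open>dagger A *v x\<close> and cancels one factor of that norm.\<close>

lemma op_norm_dagger_le: "op_norm (dagger A) \<le> op_norm A"
proof (rule op_norm_leI[OF op_norm_nonneg])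
  fix x
  let ?y = "dagger A *v x"
  have "(norm ?y)\<^sup>2 = cmod (cdot (A *v ?y) x)"
    by (simp add: cdot_matrix_left cdot_self norm_power del: of_real_power)
  also have "\<dots> \<le> norm (A *v ?y) * norm x" by (rule norm_cdot_le)
  also have "\<dots> \<le> op_norm A * norm ?y * norm x"
    by (intro mult_right_mono norm_matrix_vector_le) auto
  finally have "norm ?y * norm ?y \<le> norm ?y * (op_norm A * norm x)"
    by (simp add: power2_eq_square mult_ac)
  then show "norm ?y \<le> op_norm A * norm x"
    by (cases "?y = 0") (auto simp: op_norm_nonneg)
qed

lemma op_norm_dagger [simp]: "op_norm (dagger A) = op_norm A"
  by (metis dagger_dagger op_norm_dagger_le order_antisym)

lemma op_norm_diag:
  assumes "\<And>i. cmod (d i) \<le> b"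
  shows "op_norm (diag d) \<le> b"
proof (rule op_norm_leI)
  show b: "0 \<le> b" using assms order_trans norm_ge_zero by blast
  fix x
  have "(norm (diag d *v x))\<^sup>2 \<le> (\<Sum>i\<in>UNIV. b\<^sup>2 * (cmod (x $ i))\<^sup>2)"
    unfolding norm_sq_cvec diag_mult_vec norm_mult power_mult_distrib
    by (intro sum_mono mult_right_mono power_mono assms) auto
  also have "\<dots> = (b * norm x)\<^sup>2"
    by (simp add: power_mult_distrib norm_sq_cvec sum_distrib_left)
  finally show "norm (diag d *v x) \<le> b * norm x"
    using b by (simp add: power2_le_iff_abs_le)
qed

lemma isometry_op_norm_le:
  assumes "dagger U ** U = mat 1"
  shows "op_norm U \<le> 1"
proof (rule op_norm_leI)
  fix x
  have "cdot (U *v x) (U *v x) = cdot x x"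
    using assms by (simp add: cdot_matrix_left matrix_vector_mul_assoc)
  then have "(norm (U *v x))\<^sup>2 = (norm x)\<^sup>2"
    unfolding cdot_self of_real_eq_iff .
  then show "norm (U *v x) \<le> 1 * norm x" by simp
qed simp

lemma unitary_op_norm_le: "unitary U \<Longrightarrow> op_norm U \<le> 1"
  by (simp add: unitary_def isometry_op_norm_le)

text \<open>A column is the image of a unit basis vector. This bound and its row version make the
  weights in the diagonal estimate doubly substochastic.\<close>

lemma column_norm_le: "(\<Sum>i\<in>UNIV. (cmod (A $ i $ j))\<^sup>2) \<le> (op_norm A)\<^sup>2"
proof -
  have "norm (axis j 1 :: complex^'a) = 1" by (simp add: norm_Basis axis_in_Basis_iff Basis_complex_def)
  then have "norm (A *v axis j 1) \<le> op_norm A"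
    using norm_matrix_vector_le[of A "axis j 1"] by simp
  then have "(norm (A *v axis j 1))\<^sup>2 \<le> (op_norm A)\<^sup>2" by (rule power_mono) simp
  then show ?thesis by (simp add: norm_sq_cvec mult_axis_nth)
qed

lemma row_norm_le: "(\<Sum>j\<in>UNIV. (cmod (A $ i $ j))\<^sup>2) \<le> (op_norm A)\<^sup>2"
  using column_norm_le[of "dagger A" i] by (simp add: dagger_nth)

lemma entry_norm_le: "cmod (A $ i $ j) \<le> op_norm A"
proof -
  have "(cmod (A $ i $ j))\<^sup>2 \<le> (\<Sum>i\<in>UNIV. (cmod (A $ i $ j))\<^sup>2)"
    by (rule member_le_sum) auto
  also have "\<dots> \<le> (op_norm A)\<^sup>2" by (rule column_norm_le)
  finally show ?thesis using op_norm_nonneg power2_le_imp_le by blast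
qed


subsection \<open>Singular values\<close>

text \<open>\<open>V\<close> is only a partial isometry; completing it to a unitary is not needed, because
  \<open>diag s\<close> is still recovered as \<open>V\<^sup>\<dagger> X U\<close>.\<close>

lemma singular_value_decomposition:
  fixes X :: "'n::finite cmat"
  obtains U V and s :: "'n \<Rightarrow> real" where
    "unitary U" "op_norm V \<le> 1" "\<And>j. 0 \<le> s j"
    "X = V ** diag (\<lambda>j. of_real (s j)) ** dagger U"
    "dagger V ** X ** U = diag (\<lambda>j. of_real (s j))"
    "dagger X ** X = U ** diag (\<lambda>j. of_real ((s j)\<^sup>2)) ** dagger U"
proof -
  have "hermitian (dagger X ** X)" by (simp add: hermitian_def dagger_mult)
  then obtain U and \<mu> :: "'n \<Rightarrow> real" where
    U: "unitary U" and \<mu>: "dagger X ** X = U ** diag (\<lambda>i. of_real (\<mu> i)) ** dagger U"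
    by (rule spectral_theorem)
  define G where "G = X ** U"
  have "dagger G ** G = dagger U ** (dagger X ** X) ** U"
    by (simp add: G_def dagger_mult matrix_mul_assoc)
  also have "\<dots> = (dagger U ** U) ** diag (\<lambda>i. of_real (\<mu> i)) ** (dagger U ** U)"
    unfolding \<mu> by (simp only: matrix_mul_assoc)
  finally have GG: "dagger G ** G = diag (\<lambda>i. of_real (\<mu> i))"
    using U by (simp add: unitary_def)
  have \<mu>_eq: "\<mu> j = (\<Sum>i\<in>UNIV. (cmod (G $ i $ j))\<^sup>2)" for j
  proof -
    have "complex_of_real (\<mu> j) = (dagger G ** G) $ j $ j" by (simp add: GG diag_def)
    also have "\<dots> = (\<Sum>i\<in>UNIV. of_real ((cmod (G $ i $ j))\<^sup>2))"
      by (simp add: matrix_matrix_mult_def dagger_nth complex_norm_square mult.commute del: of_real_power)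
    finally show ?thesis unfolding of_real_sum[symmetric] of_real_eq_iff .
  qed
  define s where "s j = sqrt (\<mu> j)" for j
  have s0: "0 \<le> s j" for j by (simp add: s_def \<mu>_eq sum_nonneg)
  have s2: "(s j)\<^sup>2 = \<mu> j" for j by (simp add: s_def \<mu>_eq sum_nonneg)
  have G0: "G $ i $ j = 0" if "s j = 0" for i j
    using that s2[of j] by (simp add: \<mu>_eq sum_nonneg_eq_0_iff)
  \<comment> \<open>Pseudo-inverse of the singular values. A column of \<open>G\<close> with
    \<open>s j = 0\<close> vanishes by \<open>G0\<close>, so \<open>V ** diag s\<close> still
    returns \<open>G\<close>, while the value 0 makes \<open>V\<close> a partial isometry.\<close>
  define r where "r j = (if s j = 0 then 0 else complex_of_real (1 / s j))" for j
  define V where "V = G ** diag r"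
  have GU: "G ** dagger U = X"
    using U by (simp add: G_def unitary_def matrix_mul_assoc[symmetric])
  have "V ** diag (\<lambda>j. of_real (s j)) = G"
    using G0 by (auto simp: V_def vec_eq_iff mult_diag_nth r_def)
  then have X: "X = V ** diag (\<lambda>j. of_real (s j)) ** dagger U"
    by (simp add: GU)
  have cr: "cnj (r j) = r j" for j by (simp add: r_def)
  have V': "dagger V = diag r ** dagger G" by (simp add: V_def dagger_mult dagger_diag cr)
  have "dagger V ** X ** U = diag r ** (dagger G ** G)"
    by (simp add: V' G_def matrix_mul_assoc)
  also have "\<dots> = diag (\<lambda>j. of_real (s j))"
    unfolding GG diag_mult s2[symmetric]
    by (rule arg_cong[where f = diag]) (auto simp: r_def power2_eq_square)
  finally have D: "dagger V ** X ** U = diag (\<lambda>j. of_real (s j))" .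
  have "dagger V ** V = diag r ** (dagger G ** G) ** diag r"
    unfolding V' unfolding V_def by (simp only: matrix_mul_assoc)
  also have "\<dots> = diag (\<lambda>j. if s j = 0 then 0 else 1)"
    unfolding GG diag_mult s2[symmetric]
    by (rule arg_cong[where f = diag]) (auto simp: r_def power2_eq_square)
  finally have VV: "dagger V ** V = diag (\<lambda>j. if s j = 0 then 0 else 1)" .
  \<comment> \<open>\<open>dagger V ** V\<close> is a diagonal projection, hence a contraction, and
    the squared norm of \<open>V *v x\<close> is its quadratic form at \<open>x\<close>.\<close>
  have V1: "op_norm V \<le> 1"
  proof (rule op_norm_leI)
    fix x
    have "complex_of_real ((norm (V *v x))\<^sup>2) = cdot x (diag (\<lambda>j. if s j = 0 then 0 else 1) *v x)"
      by (simp only: cdot_self[symmetric] cdot_matrix_left matrix_vector_mul_assoc VV)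
    also have "cmod \<dots> \<le> norm x * norm (diag (\<lambda>j. if s j = 0 then 0 else 1) *v x)"
      by (rule norm_cdot_le)
    also have "\<dots> \<le> norm x * (1 * norm x)"
      by (intro mult_left_mono order_trans[OF norm_matrix_vector_le] mult_right_mono op_norm_diag) auto
    finally have "(norm (V *v x))\<^sup>2 \<le> (norm x)\<^sup>2"
      by (simp add: power2_eq_square norm_mult)
    then show "norm (V *v x) \<le> 1 * norm x" by simp
  qed simp
  show thesis
    by (rule that[OF U V1 s0 X D]) (simp only: s2 \<mu>)
qed

text \<open>In the coordinates given by \<open>U\<close> the eigenspace is spanned by the axes
  \<open>j\<close> with \<open>s j = t\<close>. Nonnegativity lets squares be compared without
  signs, and the injective map \<open>U\<close> preserves the dimension.\<close>

lemma singular_mult_eq: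
  fixes X :: "'n::finite cmat"
  assumes U: "unitary U" and s0: "\<And>j. 0 \<le> s j" and "0 \<le> t"
    and XX: "dagger X ** X = U ** diag (\<lambda>j. of_real ((s j)\<^sup>2)) ** dagger U"
  shows "singular_mult X t = card {j. s j = t}"
proof -
  let ?D = "diag (\<lambda>j. of_real ((s j)\<^sup>2)) :: 'n cmat"
  have UU: "dagger U *v (U *v y) = y" "U *v (dagger U *v y) = y" for y
    using U by (simp_all add: matrix_vector_mul_assoc unitary_def)
  have eq: "(s j)\<^sup>2 = t\<^sup>2 \<longleftrightarrow> s j = t" for j
    using s0[of j] \<open>0 \<le> t\<close> by simp
  have iff: "?D *v y = complex_of_real (t\<^sup>2) *s y \<longleftrightarrow> (\<forall>i. i \<notin> {j. s j = t} \<longrightarrow> y $ i = 0)" for y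
    unfolding vec_eq_iff diag_mult_vec vector_smult_component mult_cancel_right of_real_eq_iff eq
    by auto
  have "{v. (dagger X ** X) *v v = complex_of_real (t\<^sup>2) *s v}
      = (*v) U ` {y. \<forall>i. i \<notin> {j. s j = t} \<longrightarrow> y $ i = 0}" (is "?L = ?R")
  proof (rule set_eqI)
    fix v
    have "(dagger X ** X) *v v = U *v (?D *v (dagger U *v v))"
      unfolding XX by (simp only: matrix_vector_mul_assoc matrix_mul_assoc)
    then have "v \<in> ?L \<longleftrightarrow> U *v (?D *v (dagger U *v v)) = complex_of_real (t\<^sup>2) *s v"
      by simp
    also have "\<dots> \<longleftrightarrow> ?D *v (dagger U *v v) = complex_of_real (t\<^sup>2) *s (dagger U *v v)"
      by (metis UU vec.scale)
    also have "\<dots> \<longleftrightarrow> v \<in> ?R"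
      unfolding iff by (smt (verit, best) UU image_iff mem_Collect_eq)
    finally show "v \<in> ?L \<longleftrightarrow> v \<in> ?R" .
  qed
  moreover have "inj_on ((*v) U) S" for S
    by (metis UU(1) inj_onI)
  ultimately show ?thesis
    unfolding singular_mult_def
    by (simp only: vec.dim_image_eq[OF matrix_vector_mul_linear_gen] dim_substandard_cart)
qed

text \<open>Grouping the indices by the value of \<open>s\<close> turns the sum over distinct
  singular values with multiplicity into a sum over indices.\<close>

lemma schatten_norm_eq:
  fixes X :: "'n::finite cmat"
  assumes U: "unitary U" and s0: "\<And>j. 0 \<le> s j"
    and XX: "dagger X ** X = U ** diag (\<lambda>j. of_real ((s j)\<^sup>2)) ** dagger U"
  shows "schatten_norm p X = (\<Sum>j\<in>UNIV. s j powr p) powr (1 / p)"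
proof -
  have m: "singular_mult X t = card {j. s j = t}" if "0 \<le> t" for t
    using singular_mult_eq[OF U s0 that XX] .
  have "{t. 0 \<le> t \<and> singular_mult X t \<noteq> 0} = range s"
  proof -
    have "singular_mult X t \<noteq> 0 \<longleftrightarrow> t \<in> range s" if "0 \<le> t" for t
      unfolding m[OF that] by (auto simp: card_eq_0_iff)
    then show ?thesis using s0 by blast
  qed
  then have "(\<Sum>t | 0 \<le> t \<and> singular_mult X t \<noteq> 0. real (singular_mult X t) * t powr p)
      = (\<Sum>t\<in>range s. real (card {j. s j = t}) * t powr p)"
    using m s0 by (auto intro!: sum.cong)
  also have "\<dots> = (\<Sum>t\<in>range s. \<Sum>j\<in>{j\<in>UNIV. s j = t}. s j powr p)"
    by (rule sum.cong) auto
  also have "\<dots> = (\<Sum>j\<in>UNIV. s j powr p)"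
    by (rule sum.image_gen[symmetric]) simp
  finally show ?thesis by (simp add: schatten_norm_def)
qed

subsection \<open>Schatten norms\<close>

lemma powr_convex_combination:
  fixes x y :: real
  assumes p: "1 \<le> p" and "0 \<le> x" "0 \<le> y" "0 \<le> t" "t \<le> 1"
  shows "((1 - t) * x + t * y) powr p \<le> (1 - t) * x powr p + t * y powr p"
proof -
  \<comment> \<open>Covers the boundary cases \<open>x = 0\<close> and \<open>y = 0\<close>, where
    one term drops out; \<open>powr_convex\<close> treats positive arguments.\<close>
  have le: "(c * z) powr p \<le> c * z powr p" if "0 \<le> c" "c \<le> 1" "0 \<le> z" for c z :: real
  proof -
    have "c powr p \<le> c"
      using powr_mono'[of 1 p c] p that by (cases "c = 0") auto
    then show ?thesis using that by (simp add: powr_mult mult_right_mono)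
  qed
  consider "x = 0" | "y = 0" | "0 < x" "0 < y" using assms by fastforce
  then show ?thesis
  proof cases
    case 3
    then show ?thesis
      using convex_onD[OF powr_convex[OF p], of t x y] assms by auto
  qed (use le[of t y] le[of "1 - t" x] assms in auto)
qed

text \<open>Jensen's inequality for the weights normalised by their sum \<open>c\<close>; undoing
  the normalisation costs \<open>c powr p\<close>, which is at most \<open>c\<close> because
  \<open>c \<le> 1\<close>.\<close>

lemma powr_substochastic:
  fixes m s :: "'a \<Rightarrow> real"
  assumes p: "1 \<le> p" and fin: "finite I" and m: "\<And>i. i \<in> I \<Longrightarrow> 0 \<le> m i" "(\<Sum>i\<in>I. m i) \<le> 1"
    and s: "\<And>i. i \<in> I \<Longrightarrow> 0 \<le> s i"
  shows "(\<Sum>i\<in>I. m i * s i) powr p \<le> (\<Sum>i\<in>I. m i * s i powr p)"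
proof (cases "I = {}")
  case True
  then show ?thesis by simp
next
  case False
  have cv: "convex_on {0..} (\<lambda>x::real. x powr p)"
    by (rule convex_onI) (use powr_convex_combination[OF p] in auto)
  define c where "c = (\<Sum>i\<in>I. m i)"
  have c0: "0 \<le> c" by (simp add: c_def m sum_nonneg)
  show ?thesis
  proof (cases "c = 0")
    case True
    then have "m i = 0" if "i \<in> I" for i
      using that m fin by (simp add: c_def sum_nonneg_eq_0_iff)
    then show ?thesis by simp
  next
    case c: False
    have "(\<Sum>i\<in>I. (m i / c) *\<^sub>R s i) powr p \<le> (\<Sum>i\<in>I. (m i / c) * s i powr p)"
      by (rule convex_on_sum[OF fin False cv])
        (use m s c c0 in \<open>auto simp: sum_divide_distrib[symmetric] c_def[symmetric]\<close>)
    also have "\<dots> = (\<Sum>i\<in>I. m i * s i powr p) / c" by (simp add: sum_divide_distrib)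
    finally have *: "((\<Sum>i\<in>I. m i * s i) / c) powr p \<le> (\<Sum>i\<in>I. m i * s i powr p) / c"
      by (simp add: sum_divide_distrib)
    have "c powr p \<le> c"
      using powr_mono'[of 1 p c] p m c0 c by (auto simp: c_def)
    have "(\<Sum>i\<in>I. m i * s i) powr p = c powr p * ((\<Sum>i\<in>I. m i * s i) / c) powr p"
      using c c0 by (subst powr_mult[symmetric]) (auto intro!: divide_nonneg_nonneg sum_nonneg m s)
    also have "\<dots> \<le> c * ((\<Sum>i\<in>I. m i * s i powr p) / c)"
      by (intro mult_mono * \<open>c powr p \<le> c\<close> c0) auto
    finally show ?thesis using c by simp
  qed
qed

text \<open>By AM-GM the modulus of the \<open>k\<close>-th diagonal entry is at most \<open>a * b\<close> times the average of
  the singular values with weights \<open>(\<bar>A\<^sub>k\<^sub>j\<bar>\<^sup>2/a\<^sup>2 + \<bar>B\<^sub>j\<^sub>k\<bar>\<^sup>2/b\<^sup>2)/2\<close>, which are doubly substochastic.\<close>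

lemma diagonal_powr_sum_le_aux:
  fixes A B :: "'n::finite cmat"
  assumes p: "1 \<le> p" and A: "op_norm A \<le> a" and B: "op_norm B \<le> b" and s0: "\<And>j. 0 \<le> s j"
  shows "(\<Sum>k\<in>UNIV. cmod ((A ** diag (\<lambda>j. of_real (s j)) ** B) $ k $ k) powr p)
    \<le> (a * b) powr p * (\<Sum>j\<in>UNIV. s j powr p)"
proof -
  have a0: "0 \<le> a" and b0: "0 \<le> b" using A B op_norm_nonneg order_trans by blast+
  have nth: "(A ** diag (\<lambda>j. of_real (s j)) ** B) $ k $ k = (\<Sum>j\<in>UNIV. A $ k $ j * of_real (s j) * B $ j $ k)" for k
    by (simp add: matrix_matrix_mult_def[of "A ** diag _"] mult_diag_nth)
  show ?thesis
  \<comment> \<open>The weights \<open>m\<close> divide by \<open>a\<close> and \<open>b\<close>. If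
    one of them is 0, all entries of \<open>A\<close> or all entries of \<open>B\<close> vanish, and
    so does the diagonal.\<close>
  proof (cases "a = 0 \<or> b = 0")
    case True
    then have "op_norm A = 0 \<or> op_norm B = 0" using A B op_norm_nonneg order_antisym by metis
    then have z: "A $ k $ j * of_real (s j) * B $ j $ k = 0" for k j
      using entry_norm_le[of A k j] entry_norm_le[of B j k] by auto
    have "cmod ((A ** diag (\<lambda>j. of_real (s j)) ** B) $ k $ k) = 0" for k
      unfolding nth z by simp
    then show ?thesis by (simp add: sum_nonneg del: norm_eq_zero)
  next
    case False
    then have ab: "0 < a" "0 < b" using a0 b0 by auto
    define m where "m k j = ((cmod (A $ k $ j) / a)\<^sup>2 + (cmod (B $ j $ k) / b)\<^sup>2) / 2" for k j
    have m0: "0 \<le> m k j" for k j by (simp add: m_def)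
    have Aa: "(op_norm A / a)\<^sup>2 \<le> 1" "(op_norm B / b)\<^sup>2 \<le> 1"
      using A B ab op_norm_nonneg by (auto intro!: power_le_one divide_nonneg_pos)
    have r1: "(\<Sum>j\<in>UNIV. m k j) \<le> 1" for k
    proof -
      have "(\<Sum>j\<in>UNIV. m k j) = ((\<Sum>j\<in>UNIV. (cmod (A $ k $ j))\<^sup>2) / a\<^sup>2 + (\<Sum>j\<in>UNIV. (cmod (B $ j $ k))\<^sup>2) / b\<^sup>2) / 2"
        by (simp add: m_def sum.distrib sum_divide_distrib power_divide add_divide_distrib)
      also have "\<dots> \<le> ((op_norm A)\<^sup>2 / a\<^sup>2 + (op_norm B)\<^sup>2 / b\<^sup>2) / 2"
        by (intro divide_right_mono add_mono row_norm_le column_norm_le) auto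
      finally show ?thesis using Aa by (simp add: power_divide)
    qed
    have r2: "(\<Sum>k\<in>UNIV. m k j) \<le> 1" for j
    proof -
      have "(\<Sum>k\<in>UNIV. m k j) = ((\<Sum>k\<in>UNIV. (cmod (A $ k $ j))\<^sup>2) / a\<^sup>2 + (\<Sum>k\<in>UNIV. (cmod (B $ j $ k))\<^sup>2) / b\<^sup>2) / 2"
        by (simp add: m_def sum.distrib sum_divide_distrib power_divide add_divide_distrib)
      also have "\<dots> \<le> ((op_norm A)\<^sup>2 / a\<^sup>2 + (op_norm B)\<^sup>2 / b\<^sup>2) / 2"
        by (intro divide_right_mono add_mono row_norm_le column_norm_le) auto
      finally show ?thesis using Aa by (simp add: power_divide)
    qed
    have "cmod ((A ** diag (\<lambda>j. of_real (s j)) ** B) $ k $ k) powr p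
        \<le> (a * b) powr p * (\<Sum>j\<in>UNIV. m k j * s j powr p)" for k
    proof -
      have amgm: "cmod (A $ k $ j) * cmod (B $ j $ k) \<le> a * b * m k j" for j
      proof -
        have "0 \<le> (cmod (A $ k $ j) / a - cmod (B $ j $ k) / b)\<^sup>2" by simp
        then have "cmod (A $ k $ j) / a * (cmod (B $ j $ k) / b) \<le> m k j"
          by (simp add: m_def power2_diff mult_ac)
        then show ?thesis using ab by (simp add: field_simps)
      qed
      have "cmod ((A ** diag (\<lambda>j. of_real (s j)) ** B) $ k $ k)
          \<le> (\<Sum>j\<in>UNIV. cmod (A $ k $ j) * cmod (B $ j $ k) * s j)"
        unfolding nth by (rule order_trans[OF norm_sum]) (simp add: norm_mult s0 mult_ac)
      also have "\<dots> \<le> (\<Sum>j\<in>UNIV. a * b * m k j * s j)"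
        by (intro sum_mono mult_right_mono amgm s0)
      also have "\<dots> = a * b * (\<Sum>j\<in>UNIV. m k j * s j)"
        by (simp add: sum_distrib_left mult_ac)
      finally have "cmod ((A ** diag (\<lambda>j. of_real (s j)) ** B) $ k $ k) powr p
          \<le> (a * b * (\<Sum>j\<in>UNIV. m k j * s j)) powr p"
        using p by (intro powr_mono2) auto
      also have "\<dots> = (a * b) powr p * (\<Sum>j\<in>UNIV. m k j * s j) powr p"
        using ab by (intro powr_mult)
      also have "\<dots> \<le> (a * b) powr p * (\<Sum>j\<in>UNIV. m k j * s j powr p)"
        by (intro mult_left_mono powr_substochastic p m0 r1 s0) auto
      finally show ?thesis .
    qed
    then have "(\<Sum>k\<in>UNIV. cmod ((A ** diag (\<lambda>j. of_real (s j)) ** B) $ k $ k) powr p)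
        \<le> (\<Sum>k\<in>UNIV. (a * b) powr p * (\<Sum>j\<in>UNIV. m k j * s j powr p))"
      by (rule sum_mono)
    also have "\<dots> = (a * b) powr p * (\<Sum>j\<in>UNIV. (\<Sum>k\<in>UNIV. m k j) * s j powr p)"
      unfolding sum_distrib_left[symmetric] sum_distrib_right by (subst sum.swap) simp
    also have "\<dots> \<le> (a * b) powr p * (\<Sum>j\<in>UNIV. 1 * s j powr p)"
      by (intro mult_left_mono sum_mono mult_right_mono r2) auto
    finally show ?thesis by simp
  qed
qed

lemma schatten_norm_nonneg: "0 \<le> schatten_norm p X"
  by (simp add: schatten_norm_def)

lemma schatten_norm_powr:
  assumes "1 \<le> p" "unitary U" "\<And>j. 0 \<le> s j"
    "dagger X ** X = U ** diag (\<lambda>j. of_real ((s j)\<^sup>2)) ** dagger U"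
  shows "schatten_norm p X powr p = (\<Sum>j\<in>UNIV. s j powr p)"
  unfolding schatten_norm_eq[OF assms(2-4)] using assms(1) by (simp add: powr_powr sum_nonneg)

text \<open>Upper half of the variational description: the outer factors \<open>V\<close> and
  \<open>dagger U\<close> of a singular value decomposition are contractions and can be absorbed
  into \<open>A\<close> and \<open>B\<close>.\<close>

lemma diagonal_powr_sum_le:
  fixes A B X :: "'n::finite cmat"
  assumes p: "1 \<le> p" and A: "op_norm A \<le> a" and B: "op_norm B \<le> b"
  shows "(\<Sum>k\<in>UNIV. cmod ((A ** X ** B) $ k $ k) powr p) \<le> (a * b * schatten_norm p X) powr p"
proof -
  have a0: "0 \<le> a" and b0: "0 \<le> b" using A B op_norm_nonneg order_trans by blast+
  obtain U V and s :: "'n \<Rightarrow> real" where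
    U: "unitary U" and V: "op_norm V \<le> 1" and s: "\<And>j. 0 \<le> s j" and
    X: "X = V ** diag (\<lambda>j. of_real (s j)) ** dagger U" and
    XX: "dagger X ** X = U ** diag (\<lambda>j. of_real ((s j)\<^sup>2)) ** dagger U"
    using singular_value_decomposition[of X] by metis
  have "A ** X ** B = (A ** V) ** diag (\<lambda>j. of_real (s j)) ** (dagger U ** B)"
    unfolding X by (simp only: matrix_mul_assoc)
  moreover have "op_norm (A ** V) \<le> a" "op_norm (dagger U ** B) \<le> b"
    using op_norm_contraction_mult[OF A V] op_norm_contraction_mult[of "dagger U" 1 B b]
      unitary_op_norm_le[OF U] B by simp_all
  ultimately have "(\<Sum>k\<in>UNIV. cmod ((A ** X ** B) $ k $ k) powr p) \<le> (a * b) powr p * (\<Sum>j\<in>UNIV. s j powr p)"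
    using diagonal_powr_sum_le_aux[OF p, of "A ** V" a "dagger U ** B" b s] s by simp
  also have "\<dots> = (a * b * schatten_norm p X) powr p"
    unfolding schatten_norm_powr[OF p U s XX, symmetric]
    using a0 b0 by (simp add: powr_mult schatten_norm_nonneg)
  finally show ?thesis .
qed

text \<open>Lower half of the variational description: the contractions \<open>dagger V\<close> and
  \<open>U\<close> turn \<open>X\<close> into the diagonal matrix of its singular values, so testing
  all pairs of contractions bounds the norm.\<close>

lemma schatten_norm_leI:
  fixes X :: "'n::finite cmat"
  assumes p: "1 \<le> p" and c: "0 \<le> c"
    and le: "\<And>A B. op_norm A \<le> 1 \<Longrightarrow> op_norm B \<le> 1 \<Longrightarrow>
      (\<Sum>k\<in>UNIV. cmod ((A ** X ** B) $ k $ k) powr p) \<le> c powr p"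
  shows "schatten_norm p X \<le> c"
proof -
  obtain U V and s :: "'n \<Rightarrow> real" where
    U: "unitary U" and V: "op_norm V \<le> 1" and s: "\<And>j. 0 \<le> s j" and
    D: "dagger V ** X ** U = diag (\<lambda>j. of_real (s j))" and
    XX: "dagger X ** X = U ** diag (\<lambda>j. of_real ((s j)\<^sup>2)) ** dagger U"
    using singular_value_decomposition[of X] by metis
  have "(\<Sum>k\<in>UNIV. s k powr p) \<le> c powr p"
    using le[of "dagger V" U] V unitary_op_norm_le[OF U] s by (simp add: D diag_def)
  then have "schatten_norm p X powr p \<le> c powr p"
    by (simp add: schatten_norm_powr[OF p U s XX])
  then show ?thesis
    using p c by (meson not_le powr_less_mono2 order_less_le_trans zero_less_one)
qed

text \<open>The test contractions \<open>C\<close> and \<open>D\<close> merge with the factors: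
  \<open>C ** A\<close> and \<open>B ** D\<close> still have operator norm at most \<open>a\<close>
  and \<open>b\<close>.\<close>

lemma schatten_norm_mult_le:
  assumes p: "1 \<le> p" and A: "op_norm A \<le> a" and B: "op_norm B \<le> b"
  shows "schatten_norm p (A ** X ** B) \<le> a * b * schatten_norm p X"
proof (rule schatten_norm_leI[OF p])
  have "0 \<le> a" "0 \<le> b" using A B op_norm_nonneg order_trans by blast+
  then show "0 \<le> a * b * schatten_norm p X" by (simp add: schatten_norm_nonneg)
  fix C D :: "'a cmat" assume C: "op_norm C \<le> 1" and D: "op_norm D \<le> 1"
  have "C ** (A ** X ** B) ** D = (C ** A) ** X ** (B ** D)"
    by (simp only: matrix_mul_assoc)
  then show "(\<Sum>k\<in>UNIV. cmod ((C ** (A ** X ** B) ** D) $ k $ k) powr p) \<le> (a * b * schatten_norm p X) powr p"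
    using diagonal_powr_sum_le[OF p, of "C ** A" a "B ** D" b X]
      op_norm_contraction_mult[OF C A] op_norm_contraction_mult[OF B D] by simp
qed

lemma schatten_norm_zero [simp]: "1 \<le> p \<Longrightarrow> schatten_norm p 0 = 0"
  by (rule order_antisym[OF schatten_norm_leI schatten_norm_nonneg]) auto

lemma op_norm_scaleR_one: "op_norm (r *\<^sub>R (mat 1 :: 'n::finite cmat)) \<le> \<bar>r\<bar>"
proof -
  have "r *\<^sub>R (mat 1 :: 'n cmat) = diag (\<lambda>_. of_real r)"
    by (simp add: vec_eq_iff mat_def diag_def) (simp add: scaleR_conv_of_real)
  then show ?thesis by (simp add: op_norm_diag)
qed

lemma matrix_add_rdistrib: "(A + B) ** C = A ** C + B ** (C :: complex^'n^'m)"
  by (simp add: vec_eq_iff matrix_matrix_mult_def distrib_right sum.distrib)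

lemma mat_scaleR_mult: "(r *\<^sub>R A) ** B = r *\<^sub>R (A ** (B :: complex^'n^'m))"
  by (simp add: vec_eq_iff matrix_matrix_mult_def scaleR_sum_right)

lemma mat_mult_scaleR: "A ** (r *\<^sub>R B) = r *\<^sub>R (A ** (B :: complex^'n^'m))"
  by (simp add: vec_eq_iff matrix_matrix_mult_def scaleR_sum_right)

lemma schatten_norm_scaleR_le:
  fixes X :: "'n::finite cmat"
  assumes p: "1 \<le> p"
  shows "schatten_norm p (r *\<^sub>R X) \<le> \<bar>r\<bar> * schatten_norm p X"
proof -
  have "op_norm (mat 1 :: 'n cmat) \<le> 1"
    by (rule op_norm_leI) auto
  from schatten_norm_mult_le[OF p op_norm_scaleR_one this, of r X] show ?thesis
    by (simp add: mat_scaleR_mult)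
qed

text \<open>For fixed test contractions this is Minkowski's inequality for two diagonals. It follows
  from convexity of the power, applied to the diagonals divided by \<open>?a\<close> and
  \<open>?b\<close>, with weights \<open>?a / c\<close> and \<open>?b / c\<close>.\<close>

lemma schatten_norm_add_le:
  fixes X Y :: "'n::finite cmat"
  assumes p: "1 \<le> p"
  shows "schatten_norm p (X + Y) \<le> schatten_norm p X + schatten_norm p Y"
proof (rule schatten_norm_leI[OF p])
  let ?a = "schatten_norm p X" and ?b = "schatten_norm p Y"
  have a0: "0 \<le> ?a" and b0: "0 \<le> ?b" by (rule schatten_norm_nonneg)+
  then show "0 \<le> ?a + ?b" by simp
  fix A B :: "'n cmat" assume AB: "op_norm A \<le> 1" "op_norm B \<le> 1"
  define x where "x k = cmod ((A ** X ** B) $ k $ k)" for k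
  define y where "y k = cmod ((A ** Y ** B) $ k $ k)" for k
  have x: "(\<Sum>k\<in>UNIV. x k powr p) \<le> ?a powr p" and y: "(\<Sum>k\<in>UNIV. y k powr p) \<le> ?b powr p"
    using diagonal_powr_sum_le[OF p AB, of X] diagonal_powr_sum_le[OF p AB, of Y]
    by (simp_all add: x_def y_def)
  have x0: "0 \<le> x k" and y0: "0 \<le> y k" for k by (simp_all add: x_def y_def)
  have "A ** (X + Y) ** B = A ** X ** B + A ** Y ** B"
    by (simp add: matrix_add_ldistrib matrix_add_rdistrib)
  then have "cmod ((A ** (X + Y) ** B) $ k $ k) \<le> x k + y k" for k
    by (simp add: x_def y_def norm_triangle_ineq)
  then have "(\<Sum>k\<in>UNIV. cmod ((A ** (X + Y) ** B) $ k $ k) powr p) \<le> (\<Sum>k\<in>UNIV. (x k + y k) powr p)"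
    using p by (intro sum_mono powr_mono2) auto
  also have "\<dots> \<le> (?a + ?b) powr p"
  proof -
    \<comment> \<open>Handles a vanishing norm, where dividing by \<open>?a\<close> or
      \<open>?b\<close> would be meaningless: the corresponding diagonal is then zero.\<close>
    have zero: "f k = 0" if "(\<Sum>k\<in>UNIV. f k powr p) \<le> 0" for f :: "'n \<Rightarrow> real" and k
    proof -
      have "(\<Sum>k\<in>UNIV. f k powr p) = 0" using that by (intro order_antisym sum_nonneg) auto
      then show ?thesis by (simp add: sum_nonneg_eq_0_iff)
    qed
    consider "?a = 0" | "?b = 0" | "0 < ?a" "0 < ?b" using a0 b0 by linarith
    then show ?thesis
    proof cases
      case 1
      then have "x k = 0" for k using zero[of x k] x by simp
      then show ?thesis using y 1 by simp
    next
      case 2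
      then have "y k = 0" for k using zero[of y k] y by simp
      then show ?thesis using x 2 by simp
    next
      case 3
      define c where "c = ?a + ?b"
      have c: "0 < c" using 3 by (simp add: c_def)
      have "(x k + y k) powr p \<le> c powr p * (?a / c * (x k powr p / ?a powr p) + ?b / c * (y k powr p / ?b powr p))" for k
      proof -
        have t: "1 - ?b / c = ?a / c" using c by (simp add: c_def field_simps)
        have "(x k + y k) powr p = (c * (?a / c * (x k / ?a) + ?b / c * (y k / ?b))) powr p"
          using 3 c by (simp add: distrib_left)
        also have "\<dots> = c powr p * ((1 - ?b / c) * (x k / ?a) + ?b / c * (y k / ?b)) powr p"
          unfolding t using 3 c x0 y0 by (intro powr_mult)
        also have "\<dots> \<le> c powr p * ((1 - ?b / c) * (x k / ?a) powr p + ?b / c * (y k / ?b) powr p)"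
          using 3 c x0 y0 p by (intro mult_left_mono powr_convex_combination) (auto simp: c_def)
        finally show ?thesis unfolding t using 3 x0 y0 by (simp add: powr_divide)
      qed
      then have "(\<Sum>k\<in>UNIV. (x k + y k) powr p)
          \<le> (\<Sum>k\<in>UNIV. c powr p * (?a / c * (x k powr p / ?a powr p) + ?b / c * (y k powr p / ?b powr p)))"
        by (rule sum_mono)
      also have "\<dots> = c powr p * (?a / c * ((\<Sum>k\<in>UNIV. x k powr p) / ?a powr p) + ?b / c * ((\<Sum>k\<in>UNIV. y k powr p) / ?b powr p))"
        by (simp only: sum_distrib_left[symmetric] sum.distrib sum_divide_distrib[symmetric])
      also have "\<dots> \<le> c powr p * (?a / c * 1 + ?b / c * 1)"
        using x y 3 c by (intro mult_left_mono add_mono) auto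
      also have "\<dots> = c powr p"
        using c by (simp add: c_def add_divide_distrib[symmetric])
      finally show ?thesis by (simp add: c_def)
    qed
  qed
  finally show "(\<Sum>k\<in>UNIV. cmod ((A ** (X + Y) ** B) $ k $ k) powr p) \<le> (?a + ?b) powr p" .
qed

lemma schatten_norm_diff_le:
  assumes p: "1 \<le> p"
  shows "schatten_norm p (X - Y) \<le> schatten_norm p X + schatten_norm p Y"
  using schatten_norm_add_le[OF p, of X "(- 1) *\<^sub>R Y"] schatten_norm_scaleR_le[OF p, of "- 1" Y]
  by simp

lemma schatten_norm_sum_le:
  assumes p: "1 \<le> p"
  shows "schatten_norm p (\<Sum>i\<in>I. f i) \<le> (\<Sum>i\<in>I. schatten_norm p (f i))"
proof (induction I rule: infinite_finite_induct)
  case (insert i I)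
  then show ?case
    using schatten_norm_add_le[OF p, of "f i" "sum f I"] by simp
qed (use p in auto)

text \<open>Convergence refers to the Euclidean norm of the matrix type, which dominates
  \<open>op_norm\<close>. Writing \<open>f k\<close> as \<open>f k ** mat 1 ** mat 1\<close> bounds
  its Schatten norm by a fixed multiple of \<open>norm (f k)\<close>.\<close>

lemma schatten_norm_tendsto_zero:
  fixes f :: "nat \<Rightarrow> 'n::finite cmat"
  assumes p: "1 \<le> p" and f: "f \<longlonglongrightarrow> 0"
  shows "(\<lambda>k. schatten_norm p (f k)) \<longlonglongrightarrow> 0"
proof -
  have opn: "op_norm X \<le> norm X" for X :: "'n cmat"
  proof (rule op_norm_leI)
    fix x
    have "(cmod ((X *v x) $ i)) \<le> norm (X $ i) * norm x" for i
    proof -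
      have "(X *v x) $ i = cdot (\<chi> j. cnj (X $ i $ j)) x"
        by (simp add: matrix_vector_mult_def cdot_def)
      moreover have "norm (\<chi> j. cnj (X $ i $ j)) = norm (X $ i)"
        by (simp add: norm_vec_def L2_set_def)
      ultimately show ?thesis by (metis norm_cdot_le)
    qed
    then have "norm (X *v x) \<le> L2_set (\<lambda>i. norm (X $ i) * norm x) UNIV"
      unfolding norm_vec_def[of "X *v x"] by (intro L2_set_mono) auto
    then show "norm (X *v x) \<le> norm X * norm x"
      by (simp add: norm_vec_def[of X] L2_set_left_distrib)
  qed simp
  define C where "C = schatten_norm p (mat 1 :: 'n cmat)"
  have "op_norm (mat 1 :: 'n cmat) \<le> 1" by (rule op_norm_leI) auto
  then have le: "schatten_norm p (f k) \<le> norm (f k) * C" for k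
    using schatten_norm_mult_le[OF p opn, of "mat 1" 1 "f k" "mat 1"] by (simp add: C_def)
  have "(\<lambda>k. norm (f k) * C) \<longlonglongrightarrow> 0"
    using tendsto_mult_left_zero[OF tendsto_norm_zero[OF f]] .
  then show ?thesis
    by (rule Lim_null_comparison[rotated]) (simp add: le schatten_norm_nonneg)
qed


subsection \<open>Unitary evolution\<close>

lemma matrix_diff_ldistrib: "A ** (B - C) = A ** B - A ** (C :: complex^'n^'m)"
  by (simp add: vec_eq_iff matrix_matrix_mult_def right_diff_distrib sum_subtractf)

lemma matrix_diff_rdistrib: "(A - B) ** C = A ** C - B ** (C :: complex^'n^'m)"
  by (simp add: vec_eq_iff matrix_matrix_mult_def left_diff_distrib sum_subtractf)

lemma bounded_linear_sandwich: "bounded_linear (\<lambda>X::'n::finite cmat. A ** X ** B)"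
  unfolding linear_conv_bounded_linear[symmetric]
  by (rule linearI)
    (simp_all add: matrix_add_ldistrib matrix_add_rdistrib mat_mult_scaleR mat_scaleR_mult)

lemma tendsto_matrix_mult:
  fixes f g :: "'a \<Rightarrow> 'n::finite cmat"
  assumes "(f \<longlongrightarrow> A) F" "(g \<longlongrightarrow> B) F"
  shows "((\<lambda>x. f x ** g x) \<longlongrightarrow> A ** B) F"
  unfolding matrix_matrix_mult_def
  using assms by (intro vec_tendstoI) (auto intro!: tendsto_intros)

lemma diag_diff: "diag a - diag b = diag (\<lambda>i. a i - b i)"
  by (auto simp: vec_eq_iff diag_def)

lemma mat_one_eq_diag: "mat 1 = diag (\<lambda>_. 1)"
  by (auto simp: vec_eq_iff diag_def mat_def)

lemma op_norm_one_le: "op_norm (mat 1 :: 'n::finite cmat) \<le> 1"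
  by (simp add: mat_one_eq_diag op_norm_diag)

text \<open>The inner factors \<open>dagger U ** U\<close> cancel in every power, and conjugation by
  \<open>U\<close> is a bounded linear map, so the series reduces to scalar exponentials on the
  diagonal.\<close>

lemma mat_exp_diagonalised:
  fixes U :: "'n::finite cmat"
  assumes U: "unitary U"
  shows "mat_exp (U ** diag d ** dagger U) = U ** diag (\<lambda>j. exp (d j)) ** dagger U"
proof -
  have UU: "dagger U ** U = mat 1" "U ** dagger U = mat 1" using U by (auto simp: unitary_def)
  have pow: "mat_power (U ** diag d ** dagger U) k = U ** diag (\<lambda>j. d j ^ k) ** dagger U" for k
  proof (induction k)
    case 0
    then show ?case using UU by (simp add: mat_one_eq_diag[symmetric])
  next
    case (Suc k)
    have "mat_power (U ** diag d ** dagger U) (Suc k)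
        = U ** diag d ** (dagger U ** U) ** diag (\<lambda>j. d j ^ k) ** dagger U"
      by (simp only: mat_power.simps Suc.IH matrix_mul_assoc)
    also have "\<dots> = U ** (diag d ** diag (\<lambda>j. d j ^ k)) ** dagger U"
      by (simp only: UU matrix_mul_rid matrix_mul_assoc)
    finally show ?case by (simp add: diag_mult)
  qed
  have "(\<lambda>k. diag (\<lambda>j. d j ^ k /\<^sub>R fact k)) sums (diag (\<lambda>j. exp (d j)) :: 'n cmat)"
    unfolding sums_def
  proof (intro vec_tendstoI)
    fix i j
    have "(\<lambda>n. \<Sum>k<n. diag (\<lambda>j. d j ^ k /\<^sub>R fact k) $ i $ j) \<longlonglongrightarrow> (diag (\<lambda>j. exp (d j)) :: 'n cmat) $ i $ j"
      using exp_converges[of "d i"] by (cases "i = j") (simp_all add: diag_def sums_def)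
    then show "(\<lambda>n. (\<Sum>k<n. diag (\<lambda>j. d j ^ k /\<^sub>R fact k)) $ i $ j) \<longlonglongrightarrow> (diag (\<lambda>j. exp (d j)) :: 'n cmat) $ i $ j"
      by simp
  qed
  from bounded_linear.sums[OF bounded_linear_sandwich this, of U "dagger U"]
  have "(\<lambda>k. U ** diag (\<lambda>j. d j ^ k /\<^sub>R fact k) ** dagger U) sums (U ** diag (\<lambda>j. exp (d j)) ** dagger U)" .
  moreover have "U ** diag (\<lambda>j. d j ^ k /\<^sub>R fact k) ** dagger U = (1 / fact k) *\<^sub>R mat_power (U ** diag d ** dagger U) k" for k
  proof -
    have "diag (\<lambda>j. d j ^ k /\<^sub>R fact k) = (1 / fact k) *\<^sub>R diag (\<lambda>j. d j ^ k)"
      by (simp add: vec_eq_iff diag_def inverse_eq_divide)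
    then show ?thesis unfolding pow by (simp add: mat_mult_scaleR mat_scaleR_mult)
  qed
  ultimately show ?thesis unfolding mat_exp_def by (simp add: sums_iff)
qed

text \<open>Minus i times the commutator, the time derivative of \<open>evolution A\<close> at time
  0. The scalar is written as a diagonal matrix so that the product estimates apply to it as
  well.\<close>

definition generator :: "'n::finite cmat \<Rightarrow> 'n cmat \<Rightarrow> 'n cmat" where
  "generator A \<sigma> = diag (\<lambda>_. - \<i>) ** (A ** \<sigma> - \<sigma> ** A)"

lemma diag_const_mult: "diag (\<lambda>_. c) ** A = map_matrix ((*) c) A"
  by (simp add: vec_eq_iff diag_def matrix_matrix_mult_def if_distrib[of "\<lambda>x. x * _"] cong: if_cong)

lemma mult_diag_const: "A ** (diag (\<lambda>_. c) ** B) = diag (\<lambda>_. c) ** (A ** B)"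
  by (simp add: diag_const_mult) (simp add: vec_eq_iff matrix_matrix_mult_def sum_distrib_left mult_ac)

lemma generator_eq: "generator A \<sigma> = (diag (\<lambda>_. - \<i>) ** A) ** \<sigma> - \<sigma> ** (diag (\<lambda>_. - \<i>) ** A)"
  unfolding generator_def mult_diag_const by (simp only: matrix_diff_ldistrib matrix_mul_assoc)

text \<open>\<open>W t\<close> is the exponential of minus i t times \<open>H\<close>. In an
  eigenbasis every property becomes one of scalar phases, and conjugation by \<open>U\<close> does
  not increase the operator norm.\<close>

lemma unitary_group:
  fixes H :: "'n::finite cmat"
  assumes H: "hermitian H"
  obtains W :: "real \<Rightarrow> 'n cmat" and C where
    "\<And>t \<sigma>. evolution H t \<sigma> = W t ** \<sigma> ** W (- t)"
    "W 0 = mat 1" "\<And>s t. W (s + t) = W s ** W t" "\<And>t. op_norm (W t) \<le> 1"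
    "\<And>s :: nat \<Rightarrow> real. \<And>t. s \<longlonglongrightarrow> t \<Longrightarrow> (\<lambda>n. W (s n)) \<longlonglongrightarrow> W t"
    "0 \<le> C" "\<And>t. op_norm (W t - mat 1) \<le> C * \<bar>t\<bar>"
    "\<And>t. op_norm (W t - mat 1 - t *\<^sub>R (diag (\<lambda>_. - \<i>) ** H)) \<le> C * t\<^sup>2"
proof -
  obtain U and \<mu> :: "'n \<Rightarrow> real" where U: "unitary U"
    and HU: "H = U ** diag (\<lambda>i. of_real (\<mu> i)) ** dagger U"
    by (rule spectral_theorem[OF H])
  have UU: "dagger U ** U = mat 1" "U ** dagger U = mat 1" using U by (auto simp: unitary_def)
  define W where "W t = U ** diag (\<lambda>j. iexp (- t * \<mu> j)) ** dagger U" for t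
  have cH: "map_matrix ((*) c) H = U ** diag (\<lambda>j. c * of_real (\<mu> j)) ** dagger U" for c
  proof -
    have "map_matrix ((*) c) H = diag (\<lambda>_. c) ** (U ** (diag (\<lambda>i. of_real (\<mu> i)) ** dagger U))"
      by (simp add: diag_const_mult[symmetric] HU matrix_mul_assoc)
    also have "\<dots> = U ** (diag (\<lambda>_. c) ** diag (\<lambda>i. of_real (\<mu> i))) ** dagger U"
      by (subst mult_diag_const[symmetric]) (simp only: matrix_mul_assoc)
    finally show ?thesis by (simp add: diag_mult)
  qed
  have W_exp: "mat_exp (map_matrix ((*) c) H) = W t" if "c = - \<i> * of_real t" for c t
    unfolding cH mat_exp_diagonalised[OF U] W_def that by (simp add: mult_ac)
  have 1: "evolution H t \<sigma> = W t ** \<sigma> ** W (- t)" for t \<sigma>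
    unfolding evolution_def by (simp add: W_exp[of _ t] W_exp[of _ "- t"])
  have 2: "W 0 = mat 1"
    by (simp add: W_def mat_one_eq_diag[symmetric] UU)
  have 3: "W (s + t) = W s ** W t" for s t
  proof -
    have "W s ** W t = U ** diag (\<lambda>j. iexp (- s * \<mu> j)) ** (dagger U ** U) ** diag (\<lambda>j. iexp (- t * \<mu> j)) ** dagger U"
      by (simp only: W_def matrix_mul_assoc)
    also have "\<dots> = U ** (diag (\<lambda>j. iexp (- s * \<mu> j)) ** diag (\<lambda>j. iexp (- t * \<mu> j))) ** dagger U"
      by (simp only: UU matrix_mul_rid matrix_mul_assoc)
    also have "diag (\<lambda>j. iexp (- s * \<mu> j)) ** diag (\<lambda>j. iexp (- t * \<mu> j)) = diag (\<lambda>j. iexp (- (s + t) * \<mu> j))"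
      by (simp add: diag_mult exp_add[symmetric] algebra_simps)
    finally show ?thesis by (simp add: W_def)
  qed
  have conj_le: "op_norm (U ** D ** dagger U) \<le> op_norm D" for D
    using op_norm_contraction_mult[OF op_norm_contraction_mult[OF unitary_op_norm_le[OF U] order_refl], of "dagger U" 1 D]
      unitary_op_norm_le[OF U] by simp
  have 4: "op_norm (W t) \<le> 1" for t
    unfolding W_def by (rule order_trans[OF conj_le op_norm_diag]) simp
  have 5: "(\<lambda>n. W (s n)) \<longlonglongrightarrow> W t" if "s \<longlonglongrightarrow> t" for s :: "nat \<Rightarrow> real" and t
  proof -
    have "(\<lambda>n. diag (\<lambda>j. iexp (- s n * \<mu> j))) \<longlonglongrightarrow> (diag (\<lambda>j. iexp (- t * \<mu> j)) :: 'n cmat)"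
      by (intro vec_tendstoI) (auto simp: diag_def intro!: tendsto_intros that)
    then show ?thesis unfolding W_def by (intro tendsto_matrix_mult tendsto_const)
  qed
  define c where "c = (\<Sum>j\<in>UNIV. \<bar>\<mu> j\<bar>)"
  have c: "\<bar>\<mu> j\<bar> \<le> c" for j unfolding c_def by (rule member_le_sum) auto
  then have c0: "0 \<le> c" using abs_ge_zero order_trans by blast
  \<comment> \<open>The linear estimate for the phases needs \<open>c\<close> and the quadratic one
    \<open>c\<^sup>2\<close>; the sum serves both.\<close>
  define C where "C = c + c\<^sup>2"
  have C0: "0 \<le> C" using c0 by (simp add: C_def)
  have one: "mat 1 = U ** diag (\<lambda>_. 1) ** dagger U"
    by (simp add: mat_one_eq_diag[symmetric] UU)
  have 6: "op_norm (W t - mat 1) \<le> C * \<bar>t\<bar>" for t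
  proof -
    have "W t - mat 1 = U ** diag (\<lambda>j. iexp (- t * \<mu> j) - 1) ** dagger U"
      unfolding one W_def by (simp only: diag_diff[symmetric] matrix_diff_ldistrib matrix_diff_rdistrib)
    moreover have "cmod (iexp (- t * \<mu> j) - 1) \<le> C * \<bar>t\<bar>" for j
    proof -
      have "cmod (iexp (- t * \<mu> j) - 1) \<le> \<bar>- t * \<mu> j\<bar>"
        using iexp_approx1[of "- t * \<mu> j" 0] by simp
      also have "\<dots> \<le> C * \<bar>t\<bar>"
        using mult_left_mono[OF c[of j], of "\<bar>t\<bar>"] mult_right_mono[of c C "\<bar>t\<bar>"]
        by (simp add: abs_mult C_def mult.commute)
      finally show ?thesis .
    qed
    ultimately show ?thesis by (simp add: order_trans[OF conj_le op_norm_diag])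
  qed
  have 7: "op_norm (W t - mat 1 - t *\<^sub>R (diag (\<lambda>_. - \<i>) ** H)) \<le> C * t\<^sup>2" for t
  proof -
    have "t *\<^sub>R (diag (\<lambda>_. - \<i>) ** H) = map_matrix ((*) (- \<i> * of_real t)) H"
      unfolding diag_const_mult by (simp add: vec_eq_iff) (simp add: scaleR_conv_of_real)
    also have "\<dots> = U ** diag (\<lambda>j. - \<i> * of_real t * of_real (\<mu> j)) ** dagger U" by (rule cH)
    finally have "W t - mat 1 - t *\<^sub>R (diag (\<lambda>_. - \<i>) ** H)
        = U ** diag (\<lambda>j. iexp (- t * \<mu> j) - 1 - - \<i> * of_real t * of_real (\<mu> j)) ** dagger U"
      unfolding one W_def by (simp only: diag_diff[symmetric] matrix_diff_ldistrib matrix_diff_rdistrib)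
    moreover have "cmod (iexp (- t * \<mu> j) - 1 - - \<i> * of_real t * of_real (\<mu> j)) \<le> C * t\<^sup>2" for j
    proof -
      have "cmod (iexp (- t * \<mu> j) - 1 - - \<i> * of_real t * of_real (\<mu> j)) \<le> (t * \<mu> j)\<^sup>2 / 2"
        using iexp_approx1[of "- t * \<mu> j" 1] by (simp add: power2_eq_square abs_mult algebra_simps)
      also have "\<dots> \<le> (t * \<mu> j)\<^sup>2" by simp
      also have "\<dots> \<le> c\<^sup>2 * t\<^sup>2"
        using mult_left_mono[OF power_mono[OF c[of j] abs_ge_zero, of 2], of "t\<^sup>2"]
        by (simp add: power_mult_distrib mult.commute)
      also have "\<dots> \<le> C * t\<^sup>2" using c0 by (intro mult_right_mono) (auto simp: C_def)
      finally show ?thesis .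
    qed
    ultimately show ?thesis by (simp add: order_trans[OF conj_le op_norm_diag])
  qed
  show thesis by (rule that[of W C]) (fact 1 2 3 4 5 6 7 C0)+
qed

lemma bounded_linear_evolution: "bounded_linear (evolution H t)"
  unfolding evolution_def[abs_def] by (rule bounded_linear_sandwich)

context
  fixes H :: "'n::finite cmat"
  assumes H: "hermitian H"
begin

lemma evolution_zero: "evolution H 0 \<sigma> = \<sigma>"
  by (rule unitary_group[OF H]) simp

lemma evolution_add: "evolution H (s + t) \<sigma> = evolution H s (evolution H t \<sigma>)"
proof (rule unitary_group[OF H])
  fix W
  assume "\<And>t \<sigma>. evolution H t \<sigma> = W t ** \<sigma> ** W (- t)" and W: "\<And>s t. W (s + t) = W s ** W t"
  moreover have "W (- (s + t)) = W (- t) ** W (- s)"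
    using W[of "- t" "- s"] by (simp only: minus_add)
  ultimately show ?thesis by (simp add: matrix_mul_assoc)
qed

lemma op_norm_evolution_le: "op_norm (evolution H t \<sigma>) \<le> op_norm \<sigma>"
proof (rule unitary_group[OF H])
  fix W
  assume "\<And>t \<sigma>. evolution H t \<sigma> = W t ** \<sigma> ** W (- t)" and W: "\<And>t. op_norm (W t) \<le> 1"
  then show ?thesis
    using op_norm_contraction_mult[OF op_norm_contraction_mult[OF W order_refl] W] by simp
qed

lemma schatten_norm_evolution_le:
  assumes p: "1 \<le> p"
  shows "schatten_norm p (evolution H t \<sigma>) \<le> schatten_norm p \<sigma>"
proof (rule unitary_group[OF H])
  fix W
  assume "\<And>t \<sigma>. evolution H t \<sigma> = W t ** \<sigma> ** W (- t)" and W: "\<And>t. op_norm (W t) \<le> 1"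
  then show ?thesis
    using schatten_norm_mult_le[OF p W W, of t \<sigma> "- t"] by simp
qed

lemma tendsto_evolution:
  fixes s :: "nat \<Rightarrow> real"
  assumes "s \<longlonglongrightarrow> t" "f \<longlonglongrightarrow> \<sigma>"
  shows "(\<lambda>n. evolution H (s n) (f n)) \<longlonglongrightarrow> evolution H t \<sigma>"
proof (rule unitary_group[OF H])
  fix W
  assume W: "\<And>t \<sigma>. evolution H t \<sigma> = W t ** \<sigma> ** W (- t)"
    "\<And>s :: nat \<Rightarrow> real. \<And>t. s \<longlonglongrightarrow> t \<Longrightarrow> (\<lambda>n. W (s n)) \<longlonglongrightarrow> W t"
  show ?thesis
    unfolding W(1) by (intro tendsto_matrix_mult W(2) assms tendsto_minus)
qed

lemma evolution_first_order:
  assumes p: "1 \<le> p"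
  shows "\<exists>C\<ge>0. \<forall>t \<sigma>. schatten_norm p (evolution H t \<sigma> - \<sigma> - t *\<^sub>R generator H \<sigma>) \<le> C * t\<^sup>2 * schatten_norm p \<sigma>"
proof (rule unitary_group[OF H])
  fix W C
  assume ev: "\<And>t \<sigma>. evolution H t \<sigma> = W t ** \<sigma> ** W (- t)"
    and C0: "0 \<le> C" and K: "\<And>t. op_norm (W t - mat 1) \<le> C * \<bar>t\<bar>"
    and R: "\<And>t. op_norm (W t - mat 1 - t *\<^sub>R (diag (\<lambda>_. - \<i>) ** H)) \<le> C * t\<^sup>2"
  show ?thesis
  \<comment> \<open>Each one-sided Taylor remainder contributes \<open>C\<close>. The cross term
    \<open>(W t - mat 1) ** \<sigma> ** (W (- t) - mat 1)\<close> has a factor of order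
    \<open>t\<close> on either side and contributes \<open>C\<^sup>2\<close>.\<close>
  proof (intro exI[of _ "2 * C + C\<^sup>2"] conjI allI)
    fix t \<sigma>
    let ?G = "diag (\<lambda>_. - \<i>) ** H" and ?n = "schatten_norm p"
    have "evolution H t \<sigma> - \<sigma> - t *\<^sub>R generator H \<sigma>
        = mat 1 ** \<sigma> ** (W (- t) - mat 1 - (- t) *\<^sub>R ?G) + (W t - mat 1 - t *\<^sub>R ?G) ** \<sigma> ** mat 1
          + (W t - mat 1) ** \<sigma> ** (W (- t) - mat 1)" (is "_ = ?a + ?b + ?c")
      unfolding ev generator_eq by (simp add: matrix_diff_ldistrib matrix_diff_rdistrib matrix_add_ldistrib
          matrix_add_rdistrib mat_scaleR_mult mat_mult_scaleR algebra_simps)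
    then have "?n (evolution H t \<sigma> - \<sigma> - t *\<^sub>R generator H \<sigma>) \<le> ?n ?a + ?n ?b + ?n ?c"
      using schatten_norm_add_le[OF p, of "?a + ?b" ?c] schatten_norm_add_le[OF p, of ?a ?b] by simp
    moreover have "?n ?a \<le> C * t\<^sup>2 * ?n \<sigma>"
      using schatten_norm_mult_le[OF p op_norm_one_le R[of "- t"], of \<sigma>] by simp
    moreover have "?n ?b \<le> C * t\<^sup>2 * ?n \<sigma>"
      using schatten_norm_mult_le[OF p R[of t] op_norm_one_le, of \<sigma>] by simp
    moreover have "?n ?c \<le> C\<^sup>2 * t\<^sup>2 * ?n \<sigma>"
      using schatten_norm_mult_le[OF p K[of t] K[of "- t"], of \<sigma>]
      by (simp add: power2_eq_square mult_ac)
    ultimately show "?n (evolution H t \<sigma> - \<sigma> - t *\<^sub>R generator H \<sigma>) \<le> (2 * C + C\<^sup>2) * t\<^sup>2 * ?n \<sigma>"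
      by (simp add: algebra_simps)
  qed (use C0 in auto)
qed

end

lemma linear_generator_left: "linear (\<lambda>A. generator A \<sigma>)"
  by (rule linearI) (simp_all add: generator_def matrix_add_ldistrib matrix_add_rdistrib
      mat_mult_scaleR mat_scaleR_mult scaleR_diff_right matrix_diff_ldistrib)

lemma generator_diff_left: "generator (A - B) \<sigma> = generator A \<sigma> - generator B \<sigma>"
  by (rule linear_diff[OF linear_generator_left])

lemma generator_mean:
  "generator (mean_hamiltonian w H) \<sigma> = (\<Sum>i\<in>UNIV. w i *\<^sub>R generator (H i) \<sigma>)"
  unfolding mean_hamiltonian_def
  by (simp only: linear_sum[OF linear_generator_left] linear_scale[OF linear_generator_left])

lemma schatten_norm_generator_le:
  assumes p: "1 \<le> p"
  shows "schatten_norm p (generator A \<sigma>) \<le> 2 * op_norm A * schatten_norm p \<sigma>"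
proof -
  let ?G = "diag (\<lambda>_. - \<i>) ** A"
  have "op_norm (diag (\<lambda>_. - \<i>) :: 'a cmat) \<le> 1" by (simp add: op_norm_diag)
  from op_norm_contraction_mult[OF this order_refl] have G: "op_norm ?G \<le> op_norm A" by simp
  have "generator A \<sigma> = ?G ** \<sigma> ** mat 1 - mat 1 ** \<sigma> ** ?G" by (simp add: generator_eq)
  then show ?thesis
    using schatten_norm_diff_le[OF p, of "?G ** \<sigma> ** mat 1" "mat 1 ** \<sigma> ** ?G"]
      schatten_norm_mult_le[OF p G op_norm_one_le, of \<sigma>] schatten_norm_mult_le[OF p op_norm_one_le G, of \<sigma>]
    by simp
qed

section \<open>Mean and block Hamiltonians, and the p-norm of the weights\<close>

lemma hermitian_mean:
  assumes "\<And>i. hermitian (H i)"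
  shows "hermitian (mean_hamiltonian w H)"
  using assms by (simp add: hermitian_def vec_eq_iff dagger_nth mean_hamiltonian_def)

lemma block_hamiltonian_nth:
  "block_hamiltonian H $ a $ b = (if snd a = snd b then H (snd a) $ fst a $ fst b else 0)"
proof -
  have "block_hamiltonian H $ a $ b = (\<Sum>i\<in>UNIV. if i = snd a then (if snd a = snd b then H (snd a) $ fst a $ fst b else 0) else 0)"
    unfolding block_hamiltonian_def sum_component
    by (rule sum.cong) (auto simp: kron_def basis_proj_def)
  then show ?thesis by simp
qed

text \<open>\<open>kron A (mat 1)\<close> is block diagonal with every block equal to
  \<open>A\<close>. The difference in the bound is thus again a block Hamiltonian, and its norm
  controls each \<open>H i - A\<close>.\<close>

lemma block_hamiltonian_minus_kron:
  "block_hamiltonian H - kron A (mat 1) = block_hamiltonian (\<lambda>i. H i - A)"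
  by (simp add: vec_eq_iff block_hamiltonian_nth kron_def mat_def)

lemma sum_snd_eq:
  fixes f :: "'a::finite \<Rightarrow> 'c::comm_monoid_add" and i :: "'b::finite"
  shows "(\<Sum>a\<in>UNIV. if snd a = i then f (fst a) else 0) = (\<Sum>k\<in>UNIV. f k)"
proof -
  have "(\<Sum>a\<in>UNIV. if snd a = i then f (fst a) else 0) = (\<Sum>(k, j)\<in>UNIV \<times> UNIV. if j = i then f k else 0)"
    by (simp add: case_prod_beta)
  then show ?thesis unfolding sum.cartesian_product[symmetric] by simp
qed

text \<open>The map \<open>e\<close> embeds the system isometrically as block \<open>i\<close> and
  intertwines \<open>H i\<close> with the block Hamiltonian.\<close>

lemma op_norm_le_block:
  fixes H :: "'q::finite \<Rightarrow> 'n::finite cmat"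
  shows "op_norm (H i) \<le> op_norm (block_hamiltonian H)"
proof (rule op_norm_leI[OF op_norm_nonneg])
  fix x :: "complex^'n"
  define e :: "complex^'n \<Rightarrow> complex^('n \<times> 'q)"
    where "e y = (\<chi> a. if snd a = i then y $ fst a else 0)" for y
  have norm_e: "norm (e y) = norm y" for y
  proof -
    have "(norm (e y))\<^sup>2 = (\<Sum>a\<in>UNIV. if snd a = i then (cmod (y $ fst a))\<^sup>2 else 0)"
      unfolding norm_sq_cvec by (rule sum.cong) (auto simp: e_def)
    also have "\<dots> = (norm y)\<^sup>2"
      unfolding norm_sq_cvec by (rule sum_snd_eq[of i "\<lambda>k. (cmod (y $ k))\<^sup>2"])
    finally show ?thesis by simp
  qed
  have "(block_hamiltonian H *v e x) $ a = e (H i *v x) $ a" for a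
  proof -
    have "(block_hamiltonian H *v e x) $ a
        = (\<Sum>b\<in>UNIV. if snd b = i then (if snd a = i then H i $ fst a $ fst b * x $ fst b else 0) else 0)"
      unfolding matrix_vector_mult_def vec_lambda_beta
      by (rule sum.cong) (auto simp: block_hamiltonian_nth e_def)
    also have "\<dots> = e (H i *v x) $ a"
      unfolding sum_snd_eq[of i "\<lambda>k. if snd a = i then H i $ fst a $ k * x $ k else 0"]
      by (simp add: e_def matrix_vector_mult_def)
    finally show ?thesis .
  qed
  then have "block_hamiltonian H *v e x = e (H i *v x)" by (simp add: vec_eq_iff)
  then show "norm (H i *v x) \<le> op_norm (block_hamiltonian H) * norm x"
    using norm_matrix_vector_le[of "block_hamiltonian H" "e x"] by (simp add: norm_e)
qed

text \<open>Jensen's inequality with the uniform weights \<open>1 / q\<close>, followed by a p-th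
  root.\<close>

lemma power_mean_ge_one:
  fixes w :: "'q::finite \<Rightarrow> real"
  assumes p: "1 \<le> p" and w: "\<And>i. 0 \<le> w i" "(\<Sum>i\<in>UNIV. w i) = 1"
  shows "1 \<le> real CARD('q) powr ((p - 1) / p) * vec_pnorm p w"
proof -
  define q where "q = real CARD('q)"
  have q: "0 < q" by (simp add: q_def)
  define S where "S = (\<Sum>i\<in>UNIV. w i powr p)"
  have S0: "0 \<le> S" by (simp add: S_def sum_nonneg)
  have "(\<Sum>i\<in>UNIV. (1 / q) * w i) powr p \<le> (\<Sum>i\<in>UNIV. (1 / q) * w i powr p)"
    by (rule powr_substochastic[OF p]) (use w in \<open>auto simp: q_def\<close>)
  then have "(1 / q) powr p \<le> S / q"
    unfolding sum_distrib_left[symmetric] w S_def by simp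
  then have "q * (1 / q) powr p \<le> S" using q by (simp add: field_simps)
  then have "q powr (1 - p) \<le> S" using q by (simp add: powr_diff powr_divide)
  then have "1 \<le> q powr (p - 1) * S"
    using q by (simp add: powr_diff field_simps)
  then have "1 powr (1 / p) \<le> (q powr (p - 1) * S) powr (1 / p)"
    using p by (intro powr_mono2) auto
  also have "\<dots> = q powr ((p - 1) / p) * S powr (1 / p)"
    by (simp add: powr_mult powr_powr)
  finally show ?thesis by (simp add: vec_pnorm_def S_def q_def)
qed


subsection \<open>Trajectories\<close>

text \<open>The node sampled at the left end of a grid interval is used for the whole interval. The
  state after \<open>k\<close> steps therefore depends on \<open>y 0\<close> up to
  \<open>y (k - 1)\<close> only.\<close>

primrec grid_state ::
  "('q \<Rightarrow> 'n::finite cmat) \<Rightarrow> real \<Rightarrow> (nat \<Rightarrow> 'q) \<Rightarrow> 'n cmat \<Rightarrow> nat \<Rightarrow> 'n cmat" where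
  "grid_state H h y \<sigma> 0 = \<sigma>"
| "grid_state H h y \<sigma> (Suc k) = evolution (H (y k)) h (grid_state H h y \<sigma> k)"

lemma grid_state_cong: "(\<And>l. l < k \<Longrightarrow> y l = z l) \<Longrightarrow> grid_state H h y \<sigma> k = grid_state H h z \<sigma> k"
  by (induction k) auto

lemma grid_times_tendsto:
  fixes T t :: real
  assumes "T > 0" "0 \<le> t"
  shows "(\<lambda>N. real (nat \<lfloor>t / (T / real (Suc N))\<rfloor>) * (T / real (Suc N))) \<longlonglongrightarrow> t"
proof (rule Lim_transform2[OF tendsto_const Lim_null_comparison])
  show "(\<lambda>N. T / real (Suc N)) \<longlonglongrightarrow> 0"
    using lim_const_over_n[of T] by (rule LIMSEQ_Suc)
  show "\<forall>\<^sub>F N in sequentially. norm (t - real (nat \<lfloor>t / (T / real (Suc N))\<rfloor>) * (T / real (Suc N))) \<le> T / real (Suc N)"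
  proof (intro always_eventually allI)
    fix N
    define h where "h = T / real (Suc N)"
    have h: "h > 0" using assms by (simp add: h_def)
    define a where "a = real (nat \<lfloor>t / h\<rfloor>)"
    have "0 \<le> t / h" using assms h by simp
    then have "a = of_int \<lfloor>t / h\<rfloor>" by (simp add: a_def)
    then have "a \<le> t / h" "t / h \<le> a + 1" by linarith+
    then have "a * h \<le> t" "t \<le> a * h + h" using h by (simp_all add: field_simps)
    then show "norm (t - real (nat \<lfloor>t / (T / real (Suc N))\<rfloor>) * (T / real (Suc N))) \<le> T / real (Suc N)"
      unfolding h_def[symmetric] a_def[symmetric] by simp
  qed
qed

context
  fixes H :: "'q::finite \<Rightarrow> 'n::finite cmat"
  assumes H: "\<And>i. hermitian (H i)"
begin

text \<open>The start index has the summand 1 because the grid point just below \<open>s\<close> may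
  see another node. From the next grid point on, every left end point used lies in
  \<open>{s..<t}\<close>.\<close>

lemma grid_state_constant_node:
  assumes h: "h > 0" and "0 \<le> s" "s < t" and x: "\<forall>r\<in>{s..<t}. x r = i"
    and m: "nat \<lfloor>s / h\<rfloor> + 1 + m \<le> nat \<lfloor>t / h\<rfloor>"
  shows "grid_state H h (\<lambda>k. x (real k * h)) \<sigma> (nat \<lfloor>s / h\<rfloor> + 1 + m)
    = evolution (H i) (real m * h) (grid_state H h (\<lambda>k. x (real k * h)) \<sigma> (nat \<lfloor>s / h\<rfloor> + 1))"
  using m
proof (induction m)
  case 0
  then show ?case by (simp add: evolution_zero H)
next
  case (Suc m)
  define k where "k = nat \<lfloor>s / h\<rfloor> + 1 + m"
  have sh: "0 \<le> s / h" "0 \<le> t / h" using assms by auto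
  have "s / h \<le> real k" using sh(1) unfolding k_def by linarith
  then have "s \<le> real k * h" using h by (simp add: field_simps)
  moreover have "real k + 1 \<le> t / h" using Suc.prems sh(2) unfolding k_def by linarith
  then have "real k < t / h" by linarith
  then have "real k * h < t" using h by (simp add: field_simps)
  ultimately have "x (real k * h) = i" using x by auto
  then have "grid_state H h (\<lambda>k. x (real k * h)) \<sigma> (Suc k)
      = evolution (H i) (h + real m * h) (grid_state H h (\<lambda>k. x (real k * h)) \<sigma> (nat \<lfloor>s / h\<rfloor> + 1))"
    using Suc by (simp add: k_def evolution_add[OF H])
  then show ?case by (simp add: k_def algebra_simps)
qed

text \<open>Whatever subdivision produced \<open>\<rho>\<close>, it is the limit of the same grid
  states. This gives at once the uniqueness behind \<open>THE\<close> and the approximation by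
  sampled trajectories.\<close>

lemma traj_state_grid_limit:
  assumes T: "T > 0" and tr: "traj_state H x \<sigma> t \<rho>"
  shows "0 \<le> t \<and> (\<lambda>N. grid_state H (T / real (Suc N)) (\<lambda>k. x (real k * (T / real (Suc N)))) \<sigma>
    (nat \<lfloor>t / (T / real (Suc N))\<rfloor>)) \<longlonglongrightarrow> \<rho>"
  using tr
proof induction
  case start
  then show ?case by simp
next
  case (evolve s \<rho> t i)
  define h where "h N = T / real (Suc N)" for N
  define a where "a N = nat \<lfloor>s / h N\<rfloor>" for N
  define b where "b N = nat \<lfloor>t / h N\<rfloor>" for N
  define G where "G N = grid_state H (h N) (\<lambda>k. x (real k * h N)) \<sigma>" for N
  have h: "h N > 0" for N using T by (simp add: h_def)
  have h0: "h \<longlonglongrightarrow> 0" unfolding h_def[abs_def] using lim_const_over_n[of T] by (rule LIMSEQ_Suc)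
  have s: "0 \<le> s" and t: "0 \<le> t" using evolve by auto
  have lim_a: "(\<lambda>N. real (a N) * h N) \<longlonglongrightarrow> s" and lim_b: "(\<lambda>N. real (b N) * h N) \<longlonglongrightarrow> t"
    unfolding a_def b_def h_def using grid_times_tendsto[OF T] s t by auto
  have Ga: "(\<lambda>N. G N (a N)) \<longlonglongrightarrow> \<rho>"
    using evolve.IH by (simp add: G_def a_def h_def)
  have Ga1: "(\<lambda>N. G N (a N + 1)) \<longlonglongrightarrow> \<rho>"
  proof -
    \<comment> \<open>The node used in the grid interval around \<open>s\<close> is unknown and may
      vary with \<open>N\<close>. Summing over the finitely many nodes covers all cases, and a step
      of vanishing length tends to the identity.\<close>
    have lim: "(\<lambda>N. \<Sum>y\<in>UNIV. norm (evolution (H y) (h N) (G N (a N)) - \<rho>)) \<longlonglongrightarrow> 0"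
    proof (rule tendsto_null_sum)
      fix y
      have "(\<lambda>N. evolution (H y) (h N) (G N (a N))) \<longlonglongrightarrow> evolution (H y) 0 \<rho>"
        by (rule tendsto_evolution[OF H h0 Ga])
      then show "(\<lambda>N. norm (evolution (H y) (h N) (G N (a N)) - \<rho>)) \<longlonglongrightarrow> 0"
        unfolding evolution_zero[OF H] by (simp add: tendsto_norm_zero LIM_zero)
    qed
    have le: "norm (G N (a N + 1) - \<rho>) \<le> (\<Sum>y\<in>UNIV. norm (evolution (H y) (h N) (G N (a N)) - \<rho>))" for N
      by (rule order_trans[OF _ member_le_sum[of "x (real (a N) * h N)"]]) (auto simp: G_def)
    have "(\<lambda>N. G N (a N + 1) - \<rho>) \<longlonglongrightarrow> 0"
      by (rule Lim_null_comparison[OF always_eventually[OF allI[OF le]] lim])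
    then show ?thesis by (rule LIM_zero_cancel)
  qed
  have ev: "\<forall>\<^sub>F N in sequentially. a N + 1 \<le> b N"
  proof -
    have "\<forall>\<^sub>F N in sequentially. h N < t - s"
      using order_tendstoD(2)[OF h0, of "t - s"] evolve.hyps by simp
    then show ?thesis
    proof eventually_elim
      case (elim N)
      then have "(s + h N) / h N \<le> t / h N" using h[of N] by (intro divide_right_mono) auto
      then have "s / h N + 1 \<le> t / h N" using h[of N] by (simp add: add_divide_distrib)
      moreover have "0 \<le> s / h N" using s h[of N] by simp
      ultimately show ?case unfolding a_def b_def by linarith
    qed
  qed
  \<comment> \<open>Total length of the \<open>b N - a N - 1\<close> grid steps known to run under
    \<open>H i\<close>; the interval around \<open>s\<close> is excluded, at a cost that vanishes
    with \<open>h N\<close>.\<close>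
  have "(\<lambda>N. real (b N) * h N - real (a N) * h N - h N) \<longlonglongrightarrow> t - s - 0"
    by (intro tendsto_diff lim_a lim_b h0)
  then have "(\<lambda>N. evolution (H i) (real (b N) * h N - real (a N) * h N - h N) (G N (a N + 1)))
      \<longlonglongrightarrow> evolution (H i) (t - s) \<rho>"
    using tendsto_evolution[OF H _ Ga1] by simp
  moreover have "\<forall>\<^sub>F N in sequentially.
      evolution (H i) (real (b N) * h N - real (a N) * h N - h N) (G N (a N + 1)) = G N (b N)"
    using ev
  proof eventually_elim
    case (elim N)
    define m where "m = b N - (a N + 1)"
    have m: "b N = a N + 1 + m" using elim by (simp add: m_def)
    have "G N (a N + 1 + m) = evolution (H i) (real m * h N) (G N (a N + 1))"
      unfolding G_def a_def
      by (rule grid_state_constant_node[OF h s evolve.hyps(2) evolve.hyps(3)])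
        (use m in \<open>simp add: a_def b_def\<close>)
    moreover have "real m * h N = real (b N) * h N - real (a N) * h N - h N"
      by (simp add: m algebra_simps)
    ultimately show ?case by (simp add: m)
  qed
  ultimately have "(\<lambda>N. G N (b N)) \<longlonglongrightarrow> evolution (H i) (t - s) \<rho>"
    by (rule Lim_transform_eventually)
  then show ?case using t by (simp add: G_def b_def h_def)
qed

lemma traj_state_exists:
  assumes "step_path T x"
  shows "\<exists>\<rho>. traj_state H x \<sigma> T \<rho>"
proof -
  obtain n :: nat and t where t: "t 0 = 0" "t n = T"
    "\<And>k. k < n \<Longrightarrow> t k < t (Suc k) \<and> (\<forall>r\<in>{t k..<t (Suc k)}. x r = x (t k))"
    using assms unfolding step_path_def by blast
  have "\<exists>\<rho>. traj_state H x \<sigma> (t k) \<rho>" if "k \<le> n" for k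
    using that
  proof (induction k)
    case 0
    then show ?case using t(1) traj_state.start by metis
  next
    case (Suc k)
    then obtain \<rho> where \<rho>: "traj_state H x \<sigma> (t k) \<rho>" by auto
    have "k < n" using Suc.prems by simp
    then have "traj_state H x \<sigma> (t (Suc k)) (evolution (H (x (t k))) (t (Suc k) - t k) \<rho>)"
      using t(3) by (intro traj_state.evolve[OF \<rho>]) blast+
    then show ?case by blast
  qed
  then show ?thesis using t(2) by blast
qed

lemma grid_state_tendsto_traj_state:
  assumes T: "T > 0" and x: "step_path T x"
  shows "(\<lambda>N. grid_state H (T / real (Suc N)) (\<lambda>k. x (real k * (T / real (Suc N)))) \<sigma> (Suc N))
    \<longlonglongrightarrow> (THE \<rho>. traj_state H x \<sigma> T \<rho>)"
proof -
  have "\<lfloor>T / (T / real (Suc N))\<rfloor> = int (Suc N)" for N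
    using T by simp
  then have floor: "nat \<lfloor>T / (T / real (Suc N))\<rfloor> = Suc N" for N
    by (simp only: nat_int)
  have lim: "(\<lambda>N. grid_state H (T / real (Suc N)) (\<lambda>k. x (real k * (T / real (Suc N)))) \<sigma> (Suc N)) \<longlonglongrightarrow> \<rho>"
    if "traj_state H x \<sigma> T \<rho>" for \<rho>
    using traj_state_grid_limit[OF T that] unfolding floor by blast
  obtain \<rho> where \<rho>: "traj_state H x \<sigma> T \<rho>" using traj_state_exists[OF x] by blast
  then have "(THE \<rho>. traj_state H x \<sigma> T \<rho>) = \<rho>"
    using lim LIMSEQ_unique by (intro the_equality) blast+
  then show ?thesis using lim[OF \<rho>] by simp
qed

text \<open>Uniform in the trajectory, the mesh and the number of steps, as dominated convergence
  requires.\<close>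

lemma op_norm_grid_state_le: "op_norm (grid_state H h y \<sigma> k) \<le> op_norm \<sigma>"
  by (induction k) (auto intro: order_trans[OF op_norm_evolution_le[OF H]])

end


subsection \<open>The sampled Markov chain\<close>

text \<open>A function of the first \<open>k + 1\<close> samples takes finitely many values, so its
  integral is a finite sum over histories. Histories are extensional functions, so that there are
  finitely many and exactly one of them matches each \<open>\<omega>\<close>.\<close>

lemma (in prob_space) history_expectation:
  fixes Y :: "nat \<Rightarrow> 'a \<Rightarrow> 'q::finite" and f :: "(nat \<Rightarrow> 'q) \<Rightarrow> 'b::{banach,second_countable_topology}"
  assumes Y: "\<And>l. l \<le> k \<Longrightarrow> Y l \<in> measurable M (count_space UNIV)"
    and A: "A \<in> sets M"
    and f: "\<And>y z. (\<And>l. l \<le> k \<Longrightarrow> y l = z l) \<Longrightarrow> f y = f z"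
  shows "has_bochner_integral M (\<lambda>\<omega>. indicator A \<omega> *\<^sub>R f (\<lambda>l. Y l \<omega>))
    (\<Sum>\<pi>\<in>PiE {..k} (\<lambda>_. UNIV). prob (A \<inter> {\<omega>\<in>space M. \<forall>l\<le>k. Y l \<omega> = \<pi> l}) *\<^sub>R f \<pi>)"
proof -
  define E where "E \<pi> = {\<omega>\<in>space M. \<forall>l\<le>k. Y l \<omega> = \<pi> l}" for \<pi>
  let ?P = "PiE {..k} (\<lambda>_. UNIV :: 'q set)"
  have fin: "finite ?P" by (rule finite_PiE) auto
  have E: "E \<pi> \<in> sets M" for \<pi>
  proof -
    have "E \<pi> = (\<Inter>l\<in>{..k}. {\<omega>\<in>space M. Y l \<omega> = \<pi> l})" by (auto simp: E_def)
    moreover have "{\<omega>\<in>space M. Y l \<omega> = \<pi> l} \<in> sets M" if "l \<le> k" for l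
      using measurable_sets[OF Y[OF that], of "{\<pi> l}"] by (simp add: vimage_def Int_def conj_commute)
    ultimately show ?thesis by (auto intro!: sets.finite_INT)
  qed
  have "has_bochner_integral M (\<lambda>\<omega>. \<Sum>\<pi>\<in>?P. indicator (A \<inter> E \<pi>) \<omega> *\<^sub>R f \<pi>)
      (\<Sum>\<pi>\<in>?P. prob (A \<inter> E \<pi>) *\<^sub>R f \<pi>)"
    by (intro has_bochner_integral_sum has_bochner_integral_indicator sets.Int A E)
      (simp add: less_top[symmetric])
  moreover have "(\<Sum>\<pi>\<in>?P. indicator (A \<inter> E \<pi>) \<omega> *\<^sub>R f \<pi>) = indicator A \<omega> *\<^sub>R f (\<lambda>l. Y l \<omega>)"
    if \<omega>: "\<omega> \<in> space M" for \<omega>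
  proof -
    \<comment> \<open>The history observed at \<open>\<omega>\<close>, the only index whose summand
      can be nonzero.\<close>
    define \<pi>0 where "\<pi>0 = restrict (\<lambda>l. Y l \<omega>) {..k}"
    have "indicator (A \<inter> E \<pi>) \<omega> *\<^sub>R f \<pi> = (if \<pi> = \<pi>0 then indicator A \<omega> *\<^sub>R f \<pi>0 else 0)"
      if "\<pi> \<in> ?P" for \<pi>
    proof -
      have "\<omega> \<in> E \<pi> \<longleftrightarrow> \<pi> = \<pi>0"
        using \<omega> that by (fastforce simp: E_def \<pi>0_def PiE_def extensional_def fun_eq_iff)
      then show ?thesis by (auto simp: indicator_def)
    qed
    then have "(\<Sum>\<pi>\<in>?P. indicator (A \<inter> E \<pi>) \<omega> *\<^sub>R f \<pi>) = (\<Sum>\<pi>\<in>?P. if \<pi> = \<pi>0 then indicator A \<omega> *\<^sub>R f \<pi>0 else 0)"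
      by (rule sum.cong[OF refl])
    also have "\<dots> = indicator A \<omega> *\<^sub>R f \<pi>0"
      using fin by (simp add: \<pi>0_def)
    also have "f \<pi>0 = f (\<lambda>l. Y l \<omega>)" by (rule f) (simp add: \<pi>0_def)
    finally show ?thesis .
  qed
  ultimately show ?thesis
    unfolding E_def by (subst has_bochner_integral_cong[OF refl _ refl, symmetric]) auto
qed

text \<open>Conditions on the full history: by the Markov property the probability of moving to
  \<open>j\<close> depends only on its last entry \<open>\<pi> k\<close>, and the histories are then
  regrouped by that entry.\<close>

lemma (in prob_space) markov_history_step:
  fixes X :: "real \<Rightarrow> 'a \<Rightarrow> 'q::finite" and f :: "(nat \<Rightarrow> 'q) \<Rightarrow> 'b::{banach,second_countable_topology}"
  assumes X: "\<And>t. t \<in> {0..T} \<Longrightarrow> X t \<in> measurable M (count_space UNIV)"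
    and markov: "markov_property M T X P" and h: "h > 0" and k: "real (Suc k) * h \<le> T"
    and f: "\<And>y z. (\<And>l. l \<le> k \<Longrightarrow> y l = z l) \<Longrightarrow> f y = f z"
  shows "(LINT \<omega>|M. indicator {\<omega>\<in>space M. X (real (Suc k) * h) \<omega> = j} \<omega> *\<^sub>R f (\<lambda>l. X (real l * h) \<omega>))
    = (\<Sum>i\<in>UNIV. P h i j *\<^sub>R (LINT \<omega>|M. indicator {\<omega>\<in>space M. X (real k * h) \<omega> = i} \<omega> *\<^sub>R f (\<lambda>l. X (real l * h) \<omega>)))"
proof -
  have lT: "real l * h \<in> {0..T}" if "l \<le> Suc k" for l
  proof -
    have "real l * h \<le> real (Suc k) * h" using that h by (intro mult_right_mono) auto
    from order_trans[OF this k] show ?thesis using h by simp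
  qed
  note Y = X[OF lT]
  define E where "E \<pi> = {\<omega>\<in>space M. \<forall>l\<le>k. X (real l * h) \<omega> = \<pi> l}" for \<pi>
  define A where "A l i = {\<omega>\<in>space M. X (real l * h) \<omega> = i}" for l i
  let ?P = "PiE {..k} (\<lambda>_. UNIV :: 'q set)"
  have A: "A l i \<in> sets M" if "l \<le> Suc k" for l i
    using measurable_sets[OF Y[OF that], of "{i}"] by (simp add: A_def vimage_def Int_def conj_commute)
  have int: "(LINT \<omega>|M. indicator (A m i) \<omega> *\<^sub>R f (\<lambda>l. X (real l * h) \<omega>)) = (\<Sum>\<pi>\<in>?P. prob (A m i \<inter> E \<pi>) *\<^sub>R f \<pi>)"
    if "m \<le> Suc k" for m i
    unfolding E_def
    by (rule has_bochner_integral_integral_eq,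
        rule history_expectation[where Y = "\<lambda>l. X (real l * h)" and f = f, OF _ A[OF that]])
      (rule Y, simp, rule f, simp)
  have step: "prob (A (Suc k) j \<inter> E \<pi>) = P h (\<pi> k) j * prob (E \<pi>)" for \<pi>
  \<comment> \<open>\<open>markov_property\<close> speaks only about histories of positive
    probability; for a null history both sides are 0.\<close>
  proof (cases "prob (E \<pi>) > 0")
    case True
    define t where "t l = real l * h" for l :: nat
    define i where "i l = (if l = Suc k then j else \<pi> l)" for l
    have iE: "E \<pi> = {\<omega>\<in>space M. \<forall>l\<le>k. X (t l) \<omega> = i l}"
      by (auto simp: E_def t_def i_def)
    have "0 \<le> t 0 \<and> (\<forall>l\<le>k. t l < t (Suc l)) \<and> t (Suc k) \<le> T \<and> prob (E \<pi>) > 0"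
      using True h k by (simp add: t_def distrib_right)
    then have "\<P>(\<omega> in M. X (t (Suc k)) \<omega> = i (Suc k) \<bar> \<forall>l\<le>k. X (t l) \<omega> = i l) = P (t (Suc k) - t k) (i k) (i (Suc k))"
      using markov unfolding markov_property_def iE by blast
    then have "prob {\<omega>\<in>space M. X (t (Suc k)) \<omega> = i (Suc k) \<and> (\<forall>l\<le>k. X (t l) \<omega> = i l)} / prob (E \<pi>) = P h (\<pi> k) j"
      unfolding cond_prob_def iE[symmetric] by (simp add: t_def i_def algebra_simps)
    moreover have "{\<omega>\<in>space M. X (t (Suc k)) \<omega> = i (Suc k) \<and> (\<forall>l\<le>k. X (t l) \<omega> = i l)} = A (Suc k) j \<inter> E \<pi>"
      by (auto simp: A_def iE) (auto simp: t_def i_def)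
    ultimately show ?thesis using True by (simp add: field_simps)
  next
    case False
    then have z: "prob (E \<pi>) = 0" using measure_nonneg[of M "E \<pi>"] by linarith
    have "E \<pi> \<in> sets M"
    proof -
      have "E \<pi> = (\<Inter>l\<in>{..k}. A l (\<pi> l))" by (auto simp: E_def A_def)
      then show ?thesis using A by (auto intro!: sets.finite_INT)
    qed
    then have "prob (A (Suc k) j \<inter> E \<pi>) \<le> prob (E \<pi>)" by (intro finite_measure_mono) auto
    then show ?thesis using z measure_nonneg[of M "A (Suc k) j \<inter> E \<pi>"] by simp
  qed
  have node: "A k i \<inter> E \<pi> = (if \<pi> k = i then E \<pi> else {})" for i \<pi>
    by (auto simp: A_def E_def)
  have "(\<Sum>i\<in>UNIV. P h i j *\<^sub>R (\<Sum>\<pi>\<in>?P. prob (A k i \<inter> E \<pi>) *\<^sub>R f \<pi>))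
      = (\<Sum>\<pi>\<in>?P. \<Sum>i\<in>UNIV. (P h i j * prob (A k i \<inter> E \<pi>)) *\<^sub>R f \<pi>)"
    unfolding scaleR_sum_right scaleR_scaleR by (rule sum.swap)
  also have "\<dots> = (\<Sum>\<pi>\<in>?P. \<Sum>i\<in>UNIV. if i = \<pi> k then (P h (\<pi> k) j * prob (E \<pi>)) *\<^sub>R f \<pi> else 0)"
    by (intro sum.cong refl) (simp add: node)
  also have "\<dots> = (\<Sum>\<pi>\<in>?P. prob (A (Suc k) j \<inter> E \<pi>) *\<^sub>R f \<pi>)"
    by (simp add: step)
  finally show ?thesis
    unfolding A_def[symmetric] int[of "Suc k" j, OF order_refl] int[of k, OF le_SucI[OF order_refl]]
    by (rule sym)
qed

section \<open>Expected states restricted to the current node\<close>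

lemma norm_le_op_norm: "norm (A :: 'n::finite cmat) \<le> real CARD('n) * (real CARD('n) * op_norm A)"
proof -
  have "norm (A $ i) \<le> real CARD('n) * op_norm A" for i
  proof -
    have "norm (A $ i) \<le> (\<Sum>j\<in>UNIV. cmod (A $ i $ j))"
      unfolding norm_vec_def by (rule L2_set_le_sum) simp
    also have "\<dots> \<le> real CARD('n) * op_norm A"
      using sum_bounded_above[of UNIV "\<lambda>j. cmod (A $ i $ j)" "op_norm A"] entry_norm_le by auto
    finally show ?thesis .
  qed
  then have "(\<Sum>i\<in>UNIV. norm (A $ i)) \<le> real CARD('n) * (real CARD('n) * op_norm A)"
    using sum_bounded_above[of UNIV "\<lambda>i. norm (A $ i)" "real CARD('n) * op_norm A"] by auto
  moreover have "norm A \<le> (\<Sum>i\<in>UNIV. norm (A $ i))"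
    unfolding norm_vec_def[of A] by (rule L2_set_le_sum) simp
  ultimately show ?thesis by simp
qed

text \<open>The event fixes the node at time \<open>k * h\<close>, whereas the grid state uses only
  earlier samples; the fixed node drives the next step. Without division by the probability of the
  event, the recursion is linear.\<close>

definition node_state ::
  "'m measure \<Rightarrow> (real \<Rightarrow> 'm \<Rightarrow> 'q) \<Rightarrow> ('q \<Rightarrow> 'n::finite cmat) \<Rightarrow> real \<Rightarrow> 'n cmat \<Rightarrow> nat \<Rightarrow> 'q \<Rightarrow> 'n cmat" where
  "node_state M X H h \<sigma> k j = (LINT \<omega>|M. indicator {\<omega>\<in>space M. X (real k * h) \<omega> = j} \<omega> *\<^sub>R
    grid_state H h (\<lambda>l. X (real l * h) \<omega>) \<sigma> k)"

context
  fixes M :: "'m measure" and T :: real and X :: "real \<Rightarrow> 'm \<Rightarrow> 'q::finite"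
    and H :: "'q \<Rightarrow> 'n::finite cmat" and \<sigma> :: "'n cmat"
  assumes M: "prob_space M"
    and X: "\<And>t. t \<in> {0..T} \<Longrightarrow> X t \<in> measurable M (count_space UNIV)"
begin

interpretation prob_space M by (rule M)

lemma grid_state_integrable:
  assumes h: "h > 0" and k: "real k * h \<le> T" and A: "A \<in> sets M"
  shows "integrable M (\<lambda>\<omega>. indicator A \<omega> *\<^sub>R grid_state H h (\<lambda>l. X (real l * h) \<omega>) \<sigma> k)"
proof -
  have lT: "real l * h \<in> {0..T}" if "l \<le> k" for l
  proof -
    have "real l * h \<le> real k * h" using that h by (intro mult_right_mono) auto
    from order_trans[OF this k] show ?thesis using h by simp
  qed
  have "\<exists>I. has_bochner_integral M (\<lambda>\<omega>. indicator A \<omega> *\<^sub>R grid_state H h (\<lambda>l. X (real l * h) \<omega>) \<sigma> k) I"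
    by (rule exI, rule history_expectation[where Y = "\<lambda>l. X (real l * h)" and k = k
          and f = "\<lambda>y. grid_state H h y \<sigma> k", OF X[OF lT] A])
      (assumption, rule grid_state_cong, simp)
  then show ?thesis by (auto simp: has_bochner_integral_iff)
qed

lemma node_event:
  assumes "t \<in> {0..T}"
  shows "{\<omega>\<in>space M. X t \<omega> = j} \<in> sets M"
  using measurable_sets[OF X[OF assms], of "{j}"] by (simp add: vimage_def Int_def conj_commute)

lemma node_state_zero:
  assumes "0 \<le> T" and "\<P>(\<omega> in M. X 0 \<omega> = j) = w j"
  shows "node_state M X H h \<sigma> 0 j = w j *\<^sub>R \<sigma>"
proof -
  have "{\<omega>\<in>space M. X 0 \<omega> = j} \<in> sets M" using node_event[of 0 j] assms by simp
  from has_bochner_integral_integral_eq[OF has_bochner_integral_indicator[OF this, of \<sigma>]]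
  show ?thesis using assms by (simp add: node_state_def less_top[symmetric])
qed

text \<open>The grid state after \<open>Suc k\<close> steps depends on samples up to
  \<open>k\<close>, so \<open>markov_history_step\<close> applies to it. On the event that sample
  \<open>k\<close> is \<open>i\<close>, its last step is the linear map
  \<open>evolution (H i) h\<close>, which commutes with the integral.\<close>

lemma node_state_Suc:
  assumes markov: "markov_property M T X P" and h: "h > 0" and k: "real (Suc k) * h \<le> T"
  shows "node_state M X H h \<sigma> (Suc k) j = (\<Sum>i\<in>UNIV. P h i j *\<^sub>R evolution (H i) h (node_state M X H h \<sigma> k i))"
proof -
  have kT: "real k * h \<le> T" using h k by (simp add: algebra_simps)
  then have kT': "real k * h \<in> {0..T}" using h by simp
  have step: "(LINT \<omega>|M. indicator {\<omega>\<in>space M. X (real k * h) \<omega> = i} \<omega> *\<^sub>R grid_state H h (\<lambda>l. X (real l * h) \<omega>) \<sigma> (Suc k))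
      = evolution (H i) h (node_state M X H h \<sigma> k i)" for i
  proof -
    interpret ev: bounded_linear "evolution (H i) h" by (rule bounded_linear_evolution)
    have "(LINT \<omega>|M. indicator {\<omega>\<in>space M. X (real k * h) \<omega> = i} \<omega> *\<^sub>R grid_state H h (\<lambda>l. X (real l * h) \<omega>) \<sigma> (Suc k))
        = (LINT \<omega>|M. evolution (H i) h (indicator {\<omega>\<in>space M. X (real k * h) \<omega> = i} \<omega> *\<^sub>R grid_state H h (\<lambda>l. X (real l * h) \<omega>) \<sigma> k))"
      by (intro Bochner_Integration.integral_cong refl) (auto simp: indicator_def ev.zero)
    also have "\<dots> = evolution (H i) h (node_state M X H h \<sigma> k i)"
      unfolding node_state_def
      by (rule integral_bounded_linear[OF bounded_linear_evolution grid_state_integrable[OF h kT node_event[OF kT']]])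
    finally show ?thesis .
  qed
  have "node_state M X H h \<sigma> (Suc k) j = (\<Sum>i\<in>UNIV. P h i j *\<^sub>R (LINT \<omega>|M.
      indicator {\<omega>\<in>space M. X (real k * h) \<omega> = i} \<omega> *\<^sub>R grid_state H h (\<lambda>l. X (real l * h) \<omega>) \<sigma> (Suc k)))"
    unfolding node_state_def
    by (rule markov_history_step[OF X markov h k]) (assumption, rule grid_state_cong, simp)
  then show ?thesis unfolding step .
qed

lemma sum_node_state:
  assumes h: "h > 0" and k: "real k * h \<le> T"
  shows "(\<Sum>j\<in>UNIV. node_state M X H h \<sigma> k j) = (LINT \<omega>|M. grid_state H h (\<lambda>l. X (real l * h) \<omega>) \<sigma> k)"
proof -
  have kT: "real k * h \<in> {0..T}" using h k by simp
  have "(\<Sum>j\<in>UNIV. node_state M X H h \<sigma> k j)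
      = (LINT \<omega>|M. (\<Sum>j\<in>UNIV. indicator {\<omega>\<in>space M. X (real k * h) \<omega> = j} \<omega> *\<^sub>R grid_state H h (\<lambda>l. X (real l * h) \<omega>) \<sigma> k))"
    unfolding node_state_def
    by (rule Bochner_Integration.integral_sum[symmetric])
      (rule grid_state_integrable[OF h k node_event[OF kT]])
  also have "\<dots> = (LINT \<omega>|M. grid_state H h (\<lambda>l. X (real l * h) \<omega>) \<sigma> k)"
    by (intro Bochner_Integration.integral_cong refl)
      (simp add: indicator_def of_bool_def if_distrib[of "\<lambda>c. c *\<^sub>R _"] cong: if_cong)
  finally show ?thesis .
qed

text \<open>Dominated convergence: the sampled states converge along every trajectory under a
  constant bound. Measurability of the limit state, defined by \<open>THE\<close>, also comes from
  this convergence.\<close>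

lemma simulation_limit:
  assumes T: "T > 0" and H: "\<And>i. hermitian (H i)" and path: "\<And>\<omega>. \<omega> \<in> space M \<Longrightarrow> step_path T (\<lambda>t. X t \<omega>)"
  shows "(\<lambda>N. \<Sum>j\<in>UNIV. node_state M X H (T / real (Suc N)) \<sigma> (Suc N) j) \<longlonglongrightarrow> simulation M X H T \<sigma>"
proof -
  define h where "h N = T / real (Suc N)" for N
  have h: "h N > 0" for N using T by (simp add: h_def)
  have hT: "real (Suc N) * h N \<le> T" for N by (simp add: h_def)
  define g where "g N \<omega> = grid_state H (h N) (\<lambda>l. X (real l * h N) \<omega>) \<sigma> (Suc N)" for N \<omega>
  have int: "integrable M (g N)" for N
  proof -
    have "integrable M (\<lambda>\<omega>. indicator (space M) \<omega> *\<^sub>R g N \<omega>)"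
      unfolding g_def by (rule grid_state_integrable[OF h hT]) simp
    then show ?thesis
      by (rule Bochner_Integration.integrable_cong[THEN iffD1, rotated 2]) auto
  qed
  have lim: "(\<lambda>N. g N \<omega>) \<longlonglongrightarrow> (THE \<rho>. traj_state H (\<lambda>t. X t \<omega>) \<sigma> T \<rho>)" if "\<omega> \<in> space M" for \<omega>
    unfolding g_def h_def by (rule grid_state_tendsto_traj_state[OF H T path[OF that]])
  have "(\<lambda>N. LINT \<omega>|M. g N \<omega>) \<longlonglongrightarrow> (LINT \<omega>|M. (THE \<rho>. traj_state H (\<lambda>t. X t \<omega>) \<sigma> T \<rho>))"
  proof (rule integral_dominated_convergence)
    show "g N \<in> borel_measurable M" for N using int by auto
    show "(\<lambda>\<omega>. THE \<rho>. traj_state H (\<lambda>t. X t \<omega>) \<sigma> T \<rho>) \<in> borel_measurable M"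
      by (rule borel_measurable_LIMSEQ_metric[OF _ lim]) (use int in auto)
    show "integrable M (\<lambda>_. real CARD('n) * (real CARD('n) * op_norm \<sigma>))" by simp
    show "AE \<omega> in M. (\<lambda>N. g N \<omega>) \<longlonglongrightarrow> (THE \<rho>. traj_state H (\<lambda>t. X t \<omega>) \<sigma> T \<rho>)"
      using lim by (rule AE_I2)
    have "norm (g N \<omega>) \<le> real CARD('n) * (real CARD('n) * op_norm \<sigma>)" for N \<omega>
      unfolding g_def
      by (rule order_trans[OF norm_le_op_norm]) (simp add: mult_left_mono op_norm_grid_state_le[OF H] del: grid_state.simps)
    then show "AE \<omega> in M. norm (g N \<omega>) \<le> real CARD('n) * (real CARD('n) * op_norm \<sigma>)" for N by simp
  qed
  then show ?thesis
    unfolding simulation_def sum_node_state[OF h hT, unfolded h_def] g_def h_def .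
qed

end


subsection \<open>Error of the sampled chain\<close>

text \<open>A single step of fixed length \<open>h\<close>. Assumption \<open>rate\<close> compares
  \<open>P\<close> with the kernel that keeps the node with weight \<open>1 - lam * h\<close> and
  otherwise redraws it from \<open>w\<close>; \<open>eps\<close> measures the discrepancy per unit
  time and \<open>C\<close> the second-order remainders of the evolutions.\<close>

locale sampled_step =
  fixes p h lam eps C eta Delta :: real and H :: "'q::finite \<Rightarrow> 'n::finite cmat"
    and w :: "'q \<Rightarrow> real" and P :: "'q \<Rightarrow> 'q \<Rightarrow> real"
  assumes p: "1 \<le> p" and H: "\<And>i. hermitian (H i)"
    and w0: "\<And>i. 0 \<le> w i" and w1: "(\<Sum>i\<in>UNIV. w i) = 1"
    and h: "0 < h" and lam: "0 \<le> lam" "lam * h \<le> 1" and eps: "0 \<le> eps" and C: "0 \<le> C"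
    and P0: "\<And>i j. 0 \<le> P i j" and P1: "\<And>i. (\<Sum>j\<in>UNIV. P i j) = 1"
    and rate: "\<And>i j. \<bar>P i j - ((if i = j then 1 - lam * h else 0) + lam * h * w j)\<bar> \<le> eps * h"
    and first_order: "\<And>i \<sigma>. schatten_norm p (evolution (H i) h \<sigma> - \<sigma> - h *\<^sub>R generator (H i) \<sigma>)
      \<le> C * h\<^sup>2 * schatten_norm p \<sigma>"
    and first_order_mean: "\<And>\<sigma>. schatten_norm p (evolution (mean_hamiltonian w H) h \<sigma> - \<sigma>
      - h *\<^sub>R generator (mean_hamiltonian w H) \<sigma>) \<le> C * h\<^sup>2 * schatten_norm p \<sigma>"
    and eta: "\<And>i. op_norm (H i) \<le> eta"
    and Delta: "\<And>i. op_norm (H i - mean_hamiltonian w H) \<le> Delta"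
begin

abbreviation "nu \<equiv> schatten_norm p"
abbreviation "U i \<equiv> evolution (H i) h"
abbreviation "E \<equiv> evolution (mean_hamiltonian w H) h"

text \<open>\<open>a * h\<close> bounds the displacement caused by one \<open>U i\<close> relative
  to the norm, and \<open>h * b\<close> is the source in the recursion for \<open>deviation\<close>.
  Both retain the corrections that vanish with \<open>h\<close>, so that the estimates hold for
  finite \<open>h\<close>.\<close>

definition a where "a = 2 * eta + C * h"
definition b where "b = 2 * Delta + 2 * C * h + real CARD('q) * eps"

definition next_state :: "('q \<Rightarrow> 'n cmat) \<Rightarrow> 'q \<Rightarrow> 'n cmat" where
  "next_state \<sigma> j = (\<Sum>i\<in>UNIV. P i j *\<^sub>R U i (\<sigma> i))"

text \<open>Distance from the product state in which the node is independent of the system.\<close>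

definition deviation :: "('q \<Rightarrow> 'n cmat) \<Rightarrow> real" where
  "deviation \<sigma> = (\<Sum>j\<in>UNIV. nu (\<sigma> j - w j *\<^sub>R (\<Sum>i\<in>UNIV. \<sigma> i)))"

lemma eta0: "0 \<le> eta" using eta op_norm_nonneg order_trans by blast
lemma Delta0: "0 \<le> Delta" using Delta op_norm_nonneg order_trans by blast
lemma a0: "0 \<le> a" using eta0 C h by (simp add: a_def)
lemma b0: "0 \<le> b" using Delta0 C h eps by (simp add: b_def)
lemma deviation0: "0 \<le> deviation \<sigma>" by (simp add: deviation_def sum_nonneg schatten_norm_nonneg)

lemma nu_scale: "0 \<le> r \<Longrightarrow> nu (r *\<^sub>R X) \<le> r * nu X"
  using schatten_norm_scaleR_le[OF p, of r X] by simp

lemma U_minus_id: "nu (U i x - x) \<le> a * h * nu x"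
proof -
  have "nu (U i x - x) \<le> nu (U i x - x - h *\<^sub>R generator (H i) x) + nu (h *\<^sub>R generator (H i) x)"
    using schatten_norm_add_le[OF p, of "U i x - x - h *\<^sub>R generator (H i) x" "h *\<^sub>R generator (H i) x"] by simp
  also have "\<dots> \<le> C * h\<^sup>2 * nu x + h * (2 * eta * nu x)"
  proof (intro add_mono first_order order_trans[OF nu_scale] mult_left_mono)
    show "nu (generator (H i) x) \<le> 2 * eta * nu x"
      using schatten_norm_generator_le[OF p, of "H i" x]
        mult_right_mono[OF eta[of i] schatten_norm_nonneg[of p x]] by simp
  qed (use h in auto)
  also have "\<dots> = a * h * nu x" by (simp add: a_def algebra_simps power2_eq_square)
  finally show ?thesis .
qed

lemma sum_next_state: "(\<Sum>j\<in>UNIV. next_state \<sigma> j) = (\<Sum>i\<in>UNIV. U i (\<sigma> i))"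
proof -
  have "(\<Sum>j\<in>UNIV. next_state \<sigma> j) = (\<Sum>i\<in>UNIV. (\<Sum>j\<in>UNIV. P i j) *\<^sub>R U i (\<sigma> i))"
    unfolding next_state_def scaleR_sum_left by (rule sum.swap)
  then show ?thesis by (simp add: P1)
qed

text \<open>Carries the bound 1 on the total norm, under which the one-step estimates are made,
  along the iteration.\<close>

lemma nu_next_state: "(\<Sum>j\<in>UNIV. nu (next_state \<sigma> j)) \<le> (\<Sum>i\<in>UNIV. nu (\<sigma> i))"
proof -
  have "(\<Sum>j\<in>UNIV. nu (next_state \<sigma> j)) \<le> (\<Sum>j\<in>UNIV. \<Sum>i\<in>UNIV. P i j * nu (\<sigma> i))"
    unfolding next_state_def
    by (intro sum_mono order_trans[OF schatten_norm_sum_le[OF p]] order_trans[OF nu_scale[OF P0]]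
        mult_left_mono schatten_norm_evolution_le H p P0)
  also have "\<dots> = (\<Sum>i\<in>UNIV. (\<Sum>j\<in>UNIV. P i j) * nu (\<sigma> i))"
    unfolding sum_distrib_right by (rule sum.swap)
  finally show ?thesis by (simp add: P1)
qed

section \<open>One step from node states of total norm at most 1\<close>

context
  fixes \<sigma> :: "'q \<Rightarrow> 'n cmat"
  assumes le1: "(\<Sum>i\<in>UNIV. nu (\<sigma> i)) \<le> 1"
begin

definition "rho = (\<Sum>i\<in>UNIV. \<sigma> i)"
definition "dev j = \<sigma> j - w j *\<^sub>R rho"
text \<open>With \<open>\<sigma> j\<close> split into \<open>dev j\<close> and the product part
  \<open>w j *\<^sub>R rho\<close>, \<open>moved\<close> collects what the deviations contribute to
  the total state after a step and \<open>mixed\<close> what the product parts contribute.\<close>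

definition "moved = (\<Sum>i\<in>UNIV. U i (dev i))"
definition "mixed = (\<Sum>i\<in>UNIV. w i *\<^sub>R U i rho)"

lemma deviation_dev: "deviation \<sigma> = (\<Sum>j\<in>UNIV. nu (dev j))"
  by (simp add: deviation_def dev_def rho_def)

lemma nu_rho: "nu rho \<le> 1"
  unfolding rho_def using schatten_norm_sum_le[OF p, of \<sigma> UNIV] le1 by simp

lemma scaled_remainder: "C * h\<^sup>2 * nu rho \<le> C * h\<^sup>2"
  using mult_left_mono[OF nu_rho, of "C * h\<^sup>2"] C by simp

lemma U_split: "U j (\<sigma> j) = U j (dev j) + w j *\<^sub>R U j rho"
proof -
  interpret bounded_linear "U j" by (rule bounded_linear_evolution)
  show ?thesis by (simp add: dev_def diff scaleR)
qed

lemma sum_U: "(\<Sum>i\<in>UNIV. U i (\<sigma> i)) = moved + mixed"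
  unfolding U_split moved_def mixed_def by (rule sum.distrib)

text \<open>The deviations sum to zero, so the identity parts of the \<open>U i\<close> cancel and
  only displacements of order \<open>h\<close> remain. This is why correlation between node and
  system disturbs the total state by just \<open>a * h\<close> times its size.\<close>

lemma nu_moved: "nu moved \<le> a * h * deviation \<sigma>"
proof -
  have "(\<Sum>i\<in>UNIV. dev i) = 0"
    unfolding dev_def sum_subtractf scaleR_sum_left[symmetric] w1 by (simp add: rho_def)
  then have "moved = (\<Sum>i\<in>UNIV. U i (dev i) - dev i)" by (simp add: moved_def sum_subtractf)
  then have "nu moved \<le> (\<Sum>i\<in>UNIV. nu (U i (dev i) - dev i))"
    using schatten_norm_sum_le[OF p] by simp
  also have "\<dots> \<le> (\<Sum>i\<in>UNIV. a * h * nu (dev i))" by (intro sum_mono U_minus_id)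
  finally show ?thesis by (simp add: deviation_dev sum_distrib_left)
qed

text \<open>The generator is linear in the Hamiltonian, so averaging first-order expansions with the
  weights \<open>w\<close> gives the generator of the mean.\<close>

lemma nu_mixed_remainder:
  "nu (mixed - rho - h *\<^sub>R generator (mean_hamiltonian w H) rho) \<le> C * h\<^sup>2"
proof -
  have "mixed - rho - h *\<^sub>R generator (mean_hamiltonian w H) rho
      = (\<Sum>i\<in>UNIV. w i *\<^sub>R (U i rho - rho - h *\<^sub>R generator (H i) rho))"
  proof -
    have "(\<Sum>i\<in>UNIV. w i *\<^sub>R rho) = rho" unfolding scaleR_sum_left[symmetric] w1 by simp
    moreover have "(\<Sum>i\<in>UNIV. w i *\<^sub>R h *\<^sub>R generator (H i) rho) = h *\<^sub>R generator (mean_hamiltonian w H) rho"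
      unfolding generator_mean scaleR_sum_right by (simp add: mult.commute)
    ultimately show ?thesis
      unfolding mixed_def scaleR_diff_right sum_subtractf by simp
  qed
  also have "nu \<dots> \<le> (\<Sum>i\<in>UNIV. w i * (C * h\<^sup>2 * nu rho))"
    by (intro order_trans[OF schatten_norm_sum_le[OF p]] sum_mono order_trans[OF nu_scale[OF w0]]
        mult_left_mono first_order w0)
  also have "\<dots> = C * h\<^sup>2 * nu rho" by (simp only: sum_distrib_right[symmetric] w1 mult_1)
  finally show ?thesis using scaled_remainder by simp
qed

text \<open>The two first-order terms differ by the generator of
  \<open>H j - mean_hamiltonian w H\<close>, which is where \<open>Delta\<close> enters; the
  expansions of \<open>U j rho\<close> and \<open>mixed\<close> leave one remainder
  \<open>C * h\<^sup>2\<close> each.\<close>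

lemma nu_U_minus_mixed: "nu (U j rho - mixed) \<le> 2 * C * h\<^sup>2 + 2 * h * Delta"
proof -
  let ?G = "generator (H j - mean_hamiltonian w H) rho"
  let ?X = "U j rho - rho - h *\<^sub>R generator (H j) rho"
  let ?Y = "mixed - rho - h *\<^sub>R generator (mean_hamiltonian w H) rho"
  have eq: "U j rho - mixed = (?X - ?Y) + h *\<^sub>R ?G"
    by (simp add: generator_diff_left scaleR_diff_right)
  have "nu (U j rho - mixed) \<le> nu ?X + nu ?Y + nu (h *\<^sub>R ?G)"
    unfolding eq
    using schatten_norm_add_le[OF p, of "?X - ?Y" "h *\<^sub>R ?G"] schatten_norm_diff_le[OF p, of ?X ?Y] by linarith
  moreover have "nu ?X \<le> C * h\<^sup>2" using first_order[of j rho] scaled_remainder by simp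
  moreover have "nu (h *\<^sub>R ?G) \<le> h * (2 * Delta)"
  proof (intro order_trans[OF nu_scale] mult_left_mono)
    have "nu ?G \<le> 2 * op_norm (H j - mean_hamiltonian w H) * nu rho" by (rule schatten_norm_generator_le[OF p])
    also have "\<dots> \<le> 2 * Delta * 1"
      using Delta[of j] nu_rho Delta0 by (intro mult_mono) (auto simp: op_norm_nonneg schatten_norm_nonneg)
    finally show "nu ?G \<le> 2 * Delta" by simp
  qed (use h in auto)
  ultimately show ?thesis using nu_mixed_remainder by simp
qed

text \<open>Redrawing the node shrinks the deviation at rate \<open>lam\<close>, the shift of the
  centre by \<open>moved\<close> gives back at most \<open>a\<close>, and the differences between
  \<open>U j rho\<close> and \<open>mixed\<close> feed in \<open>Delta\<close>.\<close>

lemma deviation_next_state: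
  "deviation (next_state \<sigma>) \<le> (1 - (lam - a) * h) * deviation \<sigma> + h * b"
proof -
  let ?D = "deviation \<sigma>" and ?S = "moved + mixed"
  \<comment> \<open>Effect of the difference between \<open>P\<close> and the keep-or-redraw
    kernel.\<close>
  define Z where "Z j = (\<Sum>i\<in>UNIV. (P i j - ((if i = j then 1 - lam * h else 0) + lam * h * w j)) *\<^sub>R U i (\<sigma> i))" for j
  have Z: "nu (Z j) \<le> eps * h" for j
  proof -
    have "nu (Z j) \<le> (\<Sum>i\<in>UNIV. eps * h * nu (\<sigma> i))"
      unfolding Z_def
      by (intro order_trans[OF schatten_norm_sum_le[OF p]] sum_mono order_trans[OF schatten_norm_scaleR_le[OF p]]
          mult_mono rate schatten_norm_evolution_le H p schatten_norm_nonneg) (use eps h in auto)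
    also have "\<dots> \<le> eps * h * 1"
      unfolding sum_distrib_left[symmetric] using eps h by (intro mult_left_mono le1) auto
    finally show ?thesis by simp
  qed
  have lh: "0 \<le> 1 - lam * h" using lam by simp
  \<comment> \<open>A redraw produces exactly the new product state \<open>w j *\<^sub>R ?S\<close>.
    It cancels against the subtracted centre and leaves the factor \<open>1 - lam * h\<close> on
    everything except \<open>Z j\<close>.\<close>
  have next_eq: "next_state \<sigma> j - w j *\<^sub>R ?S
      = (1 - lam * h) *\<^sub>R (U j (dev j) + w j *\<^sub>R ((U j rho - mixed) - moved)) + Z j" for j
  proof -
    have "Z j = next_state \<sigma> j - (1 - lam * h) *\<^sub>R U j (\<sigma> j) - (lam * h * w j) *\<^sub>R ?S"
    proof -
      have "(\<Sum>i\<in>UNIV. (if i = j then 1 - lam * h else 0) *\<^sub>R U i (\<sigma> i)) = (1 - lam * h) *\<^sub>R U j (\<sigma> j)"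
        by (simp add: if_distrib[of "\<lambda>c. c *\<^sub>R _"] cong: if_cong)
      then show ?thesis
        unfolding Z_def sum_U[symmetric] next_state_def scaleR_diff_left scaleR_add_left sum_subtractf sum.distrib
          scaleR_sum_right by simp
    qed
    then show ?thesis unfolding U_split by (simp add: algebra_simps)
  qed
  have "nu (next_state \<sigma> j - w j *\<^sub>R ?S)
      \<le> (1 - lam * h) * (nu (dev j) + w j * (2 * C * h\<^sup>2 + 2 * h * Delta + a * h * ?D)) + eps * h" for j
  proof -
    have "nu (next_state \<sigma> j - w j *\<^sub>R ?S)
        \<le> (1 - lam * h) * nu (U j (dev j) + w j *\<^sub>R ((U j rho - mixed) - moved)) + eps * h"
      unfolding next_eq
      by (rule order_trans[OF schatten_norm_add_le[OF p]]) (intro add_mono nu_scale lh Z)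
    moreover have "nu (U j (dev j) + w j *\<^sub>R ((U j rho - mixed) - moved))
        \<le> nu (dev j) + w j * (2 * C * h\<^sup>2 + 2 * h * Delta + a * h * ?D)"
      by (rule order_trans[OF schatten_norm_add_le[OF p]])
        (intro add_mono schatten_norm_evolution_le H p order_trans[OF nu_scale[OF w0]] mult_left_mono w0
          order_trans[OF schatten_norm_diff_le[OF p]] nu_U_minus_mixed nu_moved)
    ultimately show ?thesis using mult_left_mono[OF _ lh] by fastforce
  qed
  then have "deviation (next_state \<sigma>)
      \<le> (\<Sum>j\<in>UNIV. (1 - lam * h) * (nu (dev j) + w j * (2 * C * h\<^sup>2 + 2 * h * Delta + a * h * ?D)) + eps * h)"
    unfolding deviation_def[of "next_state \<sigma>"] sum_next_state sum_U by (rule sum_mono)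
  also have "\<dots> = (1 - lam * h) * (?D + (2 * C * h\<^sup>2 + 2 * h * Delta + a * h * ?D)) + real CARD('q) * (eps * h)"
    by (simp add: sum.distrib sum_distrib_left[symmetric] sum_distrib_right[symmetric] w1 deviation_dev)
  \<comment> \<open>Keeps the factor \<open>1 - lam * h\<close> on \<open>?D\<close> alone; the loss
    is the nonnegative product displayed next.\<close>
  also have "\<dots> \<le> (1 - (lam - a) * h) * ?D + h * b"
  proof -
    have "(1 - (lam - a) * h) * ?D + h * b
        - ((1 - lam * h) * (?D + (2 * C * h\<^sup>2 + 2 * h * Delta + a * h * ?D)) + real CARD('q) * (eps * h))
        = lam * h * (2 * C * h\<^sup>2 + 2 * h * Delta + a * h * ?D)"
      by (simp add: b_def algebra_simps power2_eq_square)
    moreover have "0 \<le> lam * h * (2 * C * h\<^sup>2 + 2 * h * Delta + a * h * ?D)"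
      using lam h C Delta0 a0 deviation0[of \<sigma>] by (intro mult_nonneg_nonneg add_nonneg_nonneg) auto
    ultimately show ?thesis by linarith
  qed
  finally show ?thesis .
qed

text \<open>\<open>mixed\<close> and the exact step \<open>E rho\<close> share their first-order
  term, so apart from two quadratic remainders the defect is \<open>moved\<close>, which is
  proportional to the deviation.\<close>

lemma mean_evolution_defect:
  "nu ((\<Sum>j\<in>UNIV. next_state \<sigma> j) - E (\<Sum>i\<in>UNIV. \<sigma> i)) \<le> a * h * deviation \<sigma> + 2 * C * h\<^sup>2"
proof -
  let ?Y = "mixed - rho - h *\<^sub>R generator (mean_hamiltonian w H) rho"
  let ?R = "E rho - rho - h *\<^sub>R generator (mean_hamiltonian w H) rho"
  have "(\<Sum>j\<in>UNIV. next_state \<sigma> j) - E (\<Sum>i\<in>UNIV. \<sigma> i) = moved + (?Y - ?R)"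
    by (simp add: sum_next_state sum_U rho_def[symmetric])
  then have "nu ((\<Sum>j\<in>UNIV. next_state \<sigma> j) - E (\<Sum>i\<in>UNIV. \<sigma> i)) \<le> nu moved + (nu ?Y + nu ?R)"
    using schatten_norm_add_le[OF p, of moved "?Y - ?R"] schatten_norm_diff_le[OF p, of ?Y ?R] by simp
  moreover have "nu ?R \<le> C * h\<^sup>2" using first_order_mean[of rho] scaled_remainder by simp
  ultimately show ?thesis using nu_moved nu_mixed_remainder by simp
qed

end

text \<open>The induction carries three bounds together: total norm at most 1 permits the one-step
  estimates, the deviation bound controls each new defect, and the accumulated error grows linearly
  in time.\<close>

lemma sampled_error:
  fixes s :: "nat \<Rightarrow> 'q \<Rightarrow> 'n cmat"
  assumes \<rho>: "nu \<rho> \<le> 1" and s0: "\<And>j. s 0 j = w j *\<^sub>R \<rho>"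
    and step: "\<And>k. k < N \<Longrightarrow> s (Suc k) = next_state (s k)" and al: "a < lam"
  shows "nu ((\<Sum>j\<in>UNIV. s N j) - evolution (mean_hamiltonian w H) (real N * h) \<rho>)
    \<le> real N * h * (a * (b / (lam - a)) + 2 * C * h)"
proof -
  \<comment> \<open>Fixed point of the recursion for the deviation: the gain \<open>h * b\<close>
    balances the loss \<open>(lam - a) * h * D\<close>.\<close>
  define D where "D = b / (lam - a)"
  have ind: "(\<Sum>j\<in>UNIV. nu (s k j)) \<le> 1 \<and> deviation (s k) \<le> D \<and>
      nu ((\<Sum>j\<in>UNIV. s k j) - evolution (mean_hamiltonian w H) (real k * h) \<rho>) \<le> real k * h * (a * D + 2 * C * h)"
    if "k \<le> N" for k
    using that
  proof (induction k)
    case 0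
    have sum0: "(\<Sum>j\<in>UNIV. s 0 j) = \<rho>" unfolding s0 scaleR_sum_left[symmetric] w1 by simp
    have "(\<Sum>j\<in>UNIV. nu (s 0 j)) \<le> (\<Sum>j\<in>UNIV. w j * nu \<rho>)"
      unfolding s0 by (intro sum_mono nu_scale w0)
    then have "(\<Sum>j\<in>UNIV. nu (s 0 j)) \<le> 1"
      using \<rho> by (simp add: sum_distrib_right[symmetric] w1)
    moreover have "deviation (s 0) = 0" by (simp add: deviation_def sum0) (simp add: s0 p)
    moreover have "0 \<le> D" using b0 al by (simp add: D_def)
    ultimately show ?case
      using p by (simp add: sum0 evolution_zero[OF hermitian_mean[OF H]])
  next
    case (Suc k)
    let ?e = "\<lambda>k. evolution (mean_hamiltonian w H) (real k * h) \<rho>" and ?r = "\<lambda>k. \<Sum>j\<in>UNIV. s k j"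
    have IH: "(\<Sum>j\<in>UNIV. nu (s k j)) \<le> 1" "deviation (s k) \<le> D" "nu (?r k - ?e k) \<le> real k * h * (a * D + 2 * C * h)"
      using Suc by auto
    have sk: "s (Suc k) = next_state (s k)" using step Suc.prems by simp
    \<comment> \<open>Makes the coefficient of the old deviation nonnegative, so that the bound
      \<open>D\<close> may be inserted for it.\<close>
    have "(lam - a) * h \<le> 1"
      using lam(2) mult_nonneg_nonneg[OF a0 less_imp_le[OF h]] by (simp add: left_diff_distrib)
    then have "deviation (s (Suc k)) \<le> (1 - (lam - a) * h) * D + h * b"
      unfolding sk using deviation_next_state[OF IH(1)] mult_left_mono[OF IH(2), of "1 - (lam - a) * h"] by simp
    also have "h * b = (lam - a) * h * D" using al by (simp add: D_def)
    finally have 2: "deviation (s (Suc k)) \<le> D" by (simp add: algebra_simps)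
    have e_Suc: "?e (Suc k) = E (?e k)"
      using evolution_add[OF hermitian_mean[OF H, of w], where s = h and t = "real k * h" and \<sigma> = \<rho>] by (simp add: algebra_simps)
    have E_diff: "E (?r k - ?e k) = E (?r k) - E (?e k)"
      using bounded_linear_evolution by (metis bounded_linear.linear linear_diff)
    \<comment> \<open>New defect of this step plus the old error carried on by \<open>E\<close>,
      which does not increase its norm.\<close>
    have split: "?r (Suc k) - ?e (Suc k) = (?r (Suc k) - E (?r k)) + E (?r k - ?e k)"
      unfolding e_Suc E_diff by simp
    have "nu (?r (Suc k) - ?e (Suc k)) \<le> nu (?r (Suc k) - E (?r k)) + nu (E (?r k - ?e k))"
      unfolding split by (rule schatten_norm_add_le[OF p])
    also have "\<dots> \<le> (a * h * D + 2 * C * h\<^sup>2) + real k * h * (a * D + 2 * C * h)"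
    proof (intro add_mono)
      have "a * h * deviation (s k) \<le> a * h * D"
        using a0 h by (intro mult_left_mono IH(2)) auto
      then show "nu (?r (Suc k) - E (?r k)) \<le> a * h * D + 2 * C * h\<^sup>2"
        unfolding sk using mean_evolution_defect[OF IH(1)] by simp
      show "nu (E (?r k - ?e k)) \<le> real k * h * (a * D + 2 * C * h)"
        using schatten_norm_evolution_le[OF hermitian_mean[OF H] p] IH(3) by (rule order_trans)
    qed
    also have "\<dots> = real (Suc k) * h * (a * D + 2 * C * h)"
      by (simp add: algebra_simps power2_eq_square)
    finally show ?case using nu_next_state[of "s k"] IH(1) 2 sk by simp
  qed
  then show ?thesis using ind[of N] by (simp add: D_def)
qed

end

subsection \<open>The continuous-time limit\<close>

text \<open>Off the diagonal this is the given rate. On the diagonal it follows from the row sum: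
  the probability of leaving \<open>i\<close> is asymptotically \<open>lam * (1 - w i) * h\<close>,
  and the kernel of the comparison has the same leaving probability.\<close>

lemma transition_remainder_tendsto:
  fixes P :: "real \<Rightarrow> 'q::finite \<Rightarrow> 'q \<Rightarrow> real"
  assumes w1: "(\<Sum>i\<in>UNIV. w i) = 1" and P1: "\<And>h i. h > 0 \<Longrightarrow> (\<Sum>j\<in>UNIV. P h i j) = 1"
    and rate: "\<And>i j. i \<noteq> j \<Longrightarrow> ((\<lambda>h. P h i j / h) \<longlongrightarrow> lam * w j) (at_right 0)"
  shows "((\<lambda>h. (P h i j - ((if i = j then 1 - lam * h else 0) + lam * h * w j)) / h) \<longlongrightarrow> 0) (at_right 0)"
proof (cases "i = j")
  case False
  have "((\<lambda>h. P h i j / h - lam * w j) \<longlongrightarrow> lam * w j - lam * w j) (at_right 0)"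
    by (intro tendsto_diff rate False tendsto_const)
  moreover have "\<forall>\<^sub>F h in at_right 0. P h i j / h - lam * w j
      = (P h i j - ((if i = j then 1 - lam * h else 0) + lam * h * w j)) / h"
    using eventually_at_right_less[of "0::real"]
    by eventually_elim (use False in \<open>simp add: diff_divide_distrib\<close>)
  ultimately show ?thesis by (simp add: Lim_transform_eventually)
next
  case True
  have "((\<lambda>h. lam * (1 - w i) - (\<Sum>k\<in>UNIV - {i}. P h i k / h)) \<longlongrightarrow>
      lam * (1 - w i) - (\<Sum>k\<in>UNIV - {i}. lam * w k)) (at_right 0)"
    by (intro tendsto_diff tendsto_sum rate tendsto_const) auto
  moreover have "lam * (1 - w i) - (\<Sum>k\<in>UNIV - {i}. lam * w k) = 0"
  proof -
    have "(\<Sum>k\<in>UNIV - {i}. w k) = 1 - w i" using sum.remove[of UNIV i w] w1 by simp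
    then show ?thesis by (simp add: sum_distrib_left[symmetric])
  qed
  moreover have "\<forall>\<^sub>F h in at_right 0. lam * (1 - w i) - (\<Sum>k\<in>UNIV - {i}. P h i k / h)
      = (P h i j - ((if i = j then 1 - lam * h else 0) + lam * h * w j)) / h"
    using eventually_at_right_less[of "0::real"]
  proof eventually_elim
    case (elim h)
    have "P h i i = 1 - (\<Sum>k\<in>UNIV - {i}. P h i k)" using sum.remove[of UNIV i "P h i"] P1[OF elim] by simp
    then show ?case using elim True
      by (simp add: sum_divide_distrib[symmetric]) (simp add: field_simps)
  qed
  ultimately show ?thesis by (simp add: Lim_transform_eventually)
qed

text \<open>The bound free of the factor depending on \<open>p\<close>, for a single input: the
  estimate for \<open>Suc N\<close> steps of length \<open>T / Suc N\<close> passes to the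
  limit.\<close>

lemma simulation_error:
  fixes H :: "'q::finite \<Rightarrow> 'n::finite cmat" and w :: "'q \<Rightarrow> real" and X :: "real \<Rightarrow> 'm \<Rightarrow> 'q"
  assumes T: "T > 0" and p: "p \<ge> 1" and H: "\<And>i. hermitian (H i)"
    and w0: "\<And>i. w i \<ge> 0" and w1: "(\<Sum>i\<in>UNIV. w i) = 1"
    and eta: "\<And>i. op_norm (H i) \<le> eta" and Delta: "\<And>i. op_norm (H i - mean_hamiltonian w H) \<le> Delta"
    and lam: "lam > 2 * eta" and chain: "markov_chain M T X w (\<lambda>i j. lam * w j)"
    and \<rho>: "schatten_norm p \<rho> \<le> 1"
  shows "schatten_norm p (evolution (mean_hamiltonian w H) T \<rho> - simulation M X H T \<rho>)
    \<le> T * (2 * eta * (2 * Delta / (lam - 2 * eta)))"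
proof -
  let ?nu = "schatten_norm p" and ?Hm = "mean_hamiltonian w H"
  have Hm: "hermitian ?Hm" by (rule hermitian_mean[OF H])
  have eta0: "0 \<le> eta" using eta op_norm_nonneg order_trans by blast
  then have lam0: "0 < lam" using lam by simp
  have M: "prob_space M"
    and X: "\<And>t. t \<in> {0..T} \<Longrightarrow> X t \<in> measurable M (count_space UNIV)"
    and path: "\<And>\<omega>. \<omega> \<in> space M \<Longrightarrow> step_path T (\<lambda>t. X t \<omega>)"
    and init: "\<And>i. \<P>(\<omega> in M. X 0 \<omega> = i) = w i"
    using chain by (simp_all add: markov_chain_def)
  have "\<exists>P. (\<forall>h>0. \<forall>i. (\<forall>j. 0 \<le> P h i j) \<and> (\<Sum>j\<in>UNIV. P h i j) = 1) \<and> markov_property M T X P \<and>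
      (\<forall>i j. i \<noteq> j \<longrightarrow> ((\<lambda>h. P h i j / h) \<longlongrightarrow> lam * w j) (at_right 0))"
    using chain unfolding markov_chain_def by (elim conjE)
  then obtain P where P: "\<forall>h>0. \<forall>i. (\<forall>j. 0 \<le> P h i j) \<and> (\<Sum>j\<in>UNIV. P h i j) = 1"
    and markov: "markov_property M T X P"
    and rate': "\<forall>i j. i \<noteq> j \<longrightarrow> ((\<lambda>h. P h i j / h) \<longlongrightarrow> lam * w j) (at_right 0)"
    by (elim exE conjE)
  have P0: "\<And>h i j. h > 0 \<Longrightarrow> 0 \<le> P h i j" and P1: "\<And>h i. h > 0 \<Longrightarrow> (\<Sum>j\<in>UNIV. P h i j) = 1"
    using P by auto
  have rate: "((\<lambda>h. P h i j / h) \<longlongrightarrow> lam * w j) (at_right 0)" if "i \<noteq> j" for i j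
    using rate' that by simp
  define h where "h N = T / real (Suc N)" for N
  have h: "h N > 0" for N using T by (simp add: h_def)
  have h0: "h \<longlonglongrightarrow> 0" unfolding h_def[abs_def] using lim_const_over_n[of T] by (rule LIMSEQ_Suc)
  have h_right: "filterlim h (at_right 0) sequentially"
    unfolding filterlim_at using h0 h less_imp_neq[OF h] by (auto intro!: always_eventually)
  define r where "r g i j = (P g i j - ((if i = j then 1 - lam * g else 0) + lam * g * w j)) / g" for g i j
  \<comment> \<open>The sum over all pairs of nodes gives one rate error valid for every transition,
    and it still tends to 0 because the pairs are finitely many.\<close>
  define eps where "eps N = (\<Sum>i\<in>UNIV. \<Sum>j\<in>UNIV. \<bar>r (h N) i j\<bar>)" for N
  have eps0: "0 \<le> eps N" for N by (simp add: eps_def sum_nonneg)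
  have eps_lim: "eps \<longlonglongrightarrow> 0"
    unfolding eps_def[abs_def] r_def
    by (intro tendsto_null_sum tendsto_rabs_zero
        filterlim_compose[OF transition_remainder_tendsto[OF w1 P1 rate] h_right])
  have rate_le: "\<bar>P (h N) i j - ((if i = j then 1 - lam * h N else 0) + lam * h N * w j)\<bar> \<le> eps N * h N" for N i j
  proof -
    have "\<bar>r (h N) i j\<bar> \<le> (\<Sum>j\<in>UNIV. \<bar>r (h N) i j\<bar>)" by (rule member_le_sum) auto
    also have "\<dots> \<le> eps N" unfolding eps_def by (rule member_le_sum) (auto simp: sum_nonneg)
    finally have "\<bar>r (h N) i j\<bar> * h N \<le> eps N * h N" using h[of N] by (intro mult_right_mono) auto
    then show ?thesis using h[of N] by (simp add: r_def abs_divide)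
  qed
  obtain c where c0: "\<And>i. 0 \<le> c i" and c: "\<And>i t \<sigma>. ?nu (evolution (H i) t \<sigma> - \<sigma> - t *\<^sub>R generator (H i) \<sigma>) \<le> c i * t\<^sup>2 * ?nu \<sigma>"
    using evolution_first_order[OF H p] by metis
  obtain cm where cm0: "0 \<le> cm" and cm: "\<And>t \<sigma>. ?nu (evolution ?Hm t \<sigma> - \<sigma> - t *\<^sub>R generator ?Hm \<sigma>) \<le> cm * t\<^sup>2 * ?nu \<sigma>"
    using evolution_first_order[OF Hm p] by blast
  define C where "C = cm + (\<Sum>i\<in>UNIV. c i)"
  have "c i \<le> (\<Sum>i\<in>UNIV. c i)" for i by (rule member_le_sum) (auto simp: c0)
  then have cC: "c i \<le> C" "cm \<le> C" "0 \<le> C" for i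
    using cm0 sum_nonneg[of UNIV c] c0 by (auto simp: C_def intro: add_increasing)
  have le_C: "x \<le> C * t\<^sup>2 * ?nu \<sigma>" if "x \<le> d * t\<^sup>2 * ?nu \<sigma>" "d \<le> C" for x d t and \<sigma> :: "'n cmat"
    using that(1) mult_right_mono[OF mult_right_mono[OF that(2), of "t\<^sup>2"], of "?nu \<sigma>"]
    by (simp add: schatten_norm_nonneg)
  define a where "a N = 2 * eta + C * h N" for N
  define b where "b N = 2 * Delta + 2 * C * h N + real CARD('q) * eps N" for N
  have a_lim: "a \<longlonglongrightarrow> 2 * eta + C * 0" unfolding a_def[abs_def] by (intro tendsto_intros h0)
  have b_lim: "b \<longlonglongrightarrow> 2 * Delta + 2 * C * 0 + real CARD('q) * 0" unfolding b_def[abs_def] by (intro tendsto_intros h0 eps_lim)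
  let ?sig = "\<lambda>N. \<Sum>j\<in>UNIV. node_state M X H (h N) \<rho> (Suc N) j"
  have ev_lam: "\<forall>\<^sub>F N in sequentially. h N < 1 / lam"
    using order_tendstoD(2)[OF h0, of "1 / lam"] lam0 by simp
  have ev_a: "\<forall>\<^sub>F N in sequentially. a N < lam"
    using order_tendstoD(2)[OF a_lim, of lam] lam by simp
  \<comment> \<open>Both eventual conditions are needed for a step: \<open>lam * h N \<le> 1\<close>
    makes the redraw weight admissible, and \<open>a N < lam\<close> makes the deviation recursion
    contracting.\<close>
  have ev: "\<forall>\<^sub>F N in sequentially. ?nu (?sig N - evolution ?Hm T \<rho>) \<le> T * (a N * (b N / (lam - a N)) + 2 * C * h N)"
    using ev_lam ev_a
  proof eventually_elim
    case (elim N)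
    interpret step: sampled_step p "h N" lam "eps N" C eta Delta H w "P (h N)"
    proof unfold_locales
      show "lam * h N \<le> 1" using elim(1) lam0 by (simp add: field_simps)
      show "?nu (evolution (H i) (h N) \<sigma> - \<sigma> - h N *\<^sub>R generator (H i) \<sigma>) \<le> C * (h N)\<^sup>2 * ?nu \<sigma>" for i \<sigma>
        by (rule le_C[OF c cC(1)])
      show "?nu (evolution ?Hm (h N) \<sigma> - \<sigma> - h N *\<^sub>R generator ?Hm \<sigma>) \<le> C * (h N)\<^sup>2 * ?nu \<sigma>" for \<sigma>
        by (rule le_C[OF cm cC(2)])
    qed (use p H w0 w1 h lam0 eps0 cC P0 P1 rate_le eta Delta in auto)
    have hN: "real (Suc N) * h N = T" by (simp add: h_def)
    have "?nu (?sig N - evolution ?Hm (real (Suc N) * h N) \<rho>)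
        \<le> real (Suc N) * h N * (step.a * (step.b / (lam - step.a)) + 2 * C * h N)"
    proof (rule step.sampled_error[OF \<rho>])
      show "node_state M X H (h N) \<rho> 0 j = w j *\<^sub>R \<rho>" for j
        by (rule node_state_zero[OF M X]) (use T init in auto)
      show "node_state M X H (h N) \<rho> (Suc k) = step.next_state (node_state M X H (h N) \<rho> k)" if "k < Suc N" for k
      proof
        fix j
        have "real (Suc k) * h N \<le> real (Suc N) * h N" using that h[of N] by (intro mult_right_mono) auto
        then have kT: "real (Suc k) * h N \<le> T" unfolding hN .
        show "node_state M X H (h N) \<rho> (Suc k) j = step.next_state (node_state M X H (h N) \<rho> k) j"
          unfolding step.next_state_def by (rule node_state_Suc[OF M X markov h kT])
      qed
      show "step.a < lam" using elim(2) by (simp add: step.a_def a_def)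
    qed
    then show ?case unfolding hN step.a_def step.b_def a_def b_def .
  qed
  have sim: "(\<lambda>N. ?nu (?sig N - simulation M X H T \<rho>)) \<longlonglongrightarrow> 0"
    unfolding h_def
    by (rule schatten_norm_tendsto_zero[OF p LIM_zero[OF simulation_limit[OF M X T H path]]])
  have "\<forall>\<^sub>F N in sequentially. ?nu (evolution ?Hm T \<rho> - simulation M X H T \<rho>)
      \<le> T * (a N * (b N / (lam - a N)) + 2 * C * h N) + ?nu (?sig N - simulation M X H T \<rho>)"
    using ev
  proof eventually_elim
    case (elim N)
    have "evolution ?Hm T \<rho> - simulation M X H T \<rho>
        = (?sig N - simulation M X H T \<rho>) - (?sig N - evolution ?Hm T \<rho>)" by simp
    then have "?nu (evolution ?Hm T \<rho> - simulation M X H T \<rho>)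
        \<le> ?nu (?sig N - simulation M X H T \<rho>) + ?nu (?sig N - evolution ?Hm T \<rho>)"
      by (metis schatten_norm_diff_le[OF p])
    then show ?case using elim by simp
  qed
  \<comment> \<open>The denominator has the limit \<open>lam - 2 * eta\<close>, which is nonzero by
    the assumption on \<open>lam\<close>.\<close>
  moreover have "(\<lambda>N. T * (a N * (b N / (lam - a N)) + 2 * C * h N) + ?nu (?sig N - simulation M X H T \<rho>))
      \<longlonglongrightarrow> T * ((2 * eta + C * 0) * ((2 * Delta + 2 * C * 0 + real CARD('q) * 0) / (lam - (2 * eta + C * 0))) + 2 * C * 0) + 0"
    by (intro tendsto_add tendsto_mult tendsto_divide tendsto_diff tendsto_const a_lim b_lim h0 sim) (use lam in simp)
  ultimately have "?nu (evolution ?Hm T \<rho> - simulation M X H T \<rho>)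
      \<le> T * ((2 * eta + C * 0) * ((2 * Delta + 2 * C * 0 + real CARD('q) * 0) / (lam - (2 * eta + C * 0))) + 2 * C * 0) + 0"
    by (intro tendsto_lowerbound) auto
  then show ?thesis by simp
qed

theorem mainTheorem5:
  fixes H :: "'q::finite \<Rightarrow> complex^'n::finite^'n"
    and w :: "'q \<Rightarrow> real"
    and p T lam :: real
    and M :: "'m measure"
    and X :: "real \<Rightarrow> 'm \<Rightarrow> 'q"
  assumes "T > 0" and "p \<ge> 1"
    and "\<And>i. hermitian (H i)"
    and "\<And>i. w i \<ge> 0" and "(\<Sum>i\<in>UNIV. w i) = 1"
    and "lam > 2 * real CARD('q) powr ((p - 1) / p) * op_norm (block_hamiltonian H) * vec_pnorm p w"
    and "markov_chain M T X w (\<lambda>i j. lam * w j)"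
  shows "induced_norm p (\<lambda>\<sigma>. evolution (mean_hamiltonian w H) T \<sigma> - simulation M X H T \<sigma>)
    \<le> 4 * real CARD('q) powr ((p - 1) / p) * vec_pnorm p w
        * op_norm (block_hamiltonian H - kron (mean_hamiltonian w H) (mat 1))
        * op_norm (block_hamiltonian H) * T
      / (lam - 2 * real CARD('q) powr ((p - 1) / p) * op_norm (block_hamiltonian H) * vec_pnorm p w)"
proof -
  define c where "c = real CARD('q) powr ((p - 1) / p) * vec_pnorm p w"
  define eta where "eta = op_norm (block_hamiltonian H)"
  define Delta where "Delta = op_norm (block_hamiltonian H - kron (mean_hamiltonian w H) (mat 1))"
  have c1: "1 \<le> c" unfolding c_def by (rule power_mean_ge_one) (use assms in auto)
  have eta0: "0 \<le> eta" and Delta0: "0 \<le> Delta" by (simp_all add: eta_def Delta_def op_norm_nonneg)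
  have lam_c: "2 * c * eta < lam" using assms(6) by (simp add: c_def eta_def mult_ac)
  have "eta \<le> c * eta" using mult_right_mono[OF c1 eta0] by simp
  then have lam: "2 * eta < lam" using lam_c by simp
  have le_eta: "op_norm (H i) \<le> eta" for i unfolding eta_def by (rule op_norm_le_block)
  have le_Delta: "op_norm (H i - mean_hamiltonian w H) \<le> Delta" for i
    unfolding Delta_def block_hamiltonian_minus_kron
    using op_norm_le_block[of "\<lambda>i. H i - mean_hamiltonian w H" i] .
  have "induced_norm p (\<lambda>\<sigma>. evolution (mean_hamiltonian w H) T \<sigma> - simulation M X H T \<sigma>)
      \<le> T * (2 * eta * (2 * Delta / (lam - 2 * eta)))"
    unfolding induced_norm_def
  proof (rule cSUP_least)
    show "{\<rho> :: 'n cmat. schatten_norm p \<rho> \<le> 1} \<noteq> {}"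
      using schatten_norm_zero[OF assms(2)] by (metis (mono_tags, lifting) empty_iff mem_Collect_eq zero_le_one)
    show "schatten_norm p (evolution (mean_hamiltonian w H) T \<rho> - simulation M X H T \<rho>)
        \<le> T * (2 * eta * (2 * Delta / (lam - 2 * eta)))" if "\<rho> \<in> {\<rho>. schatten_norm p \<rho> \<le> 1}" for \<rho>
      using simulation_error[OF assms(1-5) le_eta le_Delta lam assms(7)] that by blast
  qed
  also have "\<dots> = 4 * Delta * eta * T / (lam - 2 * eta)" by (simp add: mult_ac)
  \<comment> \<open>Since \<open>c\<close> is at least 1, it enlarges the numerator and shrinks the
    denominator, which stays positive by the hypothesis on \<open>lam\<close>.\<close>
  also have "\<dots> \<le> 4 * c * Delta * eta * T / (lam - 2 * c * eta)"
  proof (rule frac_le)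
    have "1 * (4 * Delta * eta * T) \<le> c * (4 * Delta * eta * T)"
      using c1 eta0 Delta0 assms(1) by (intro mult_right_mono) auto
    then show "4 * Delta * eta * T \<le> 4 * c * Delta * eta * T" by (simp add: mult_ac)
    show "0 \<le> 4 * c * Delta * eta * T" using c1 eta0 Delta0 assms(1) by simp
    show "lam - 2 * c * eta \<le> lam - 2 * eta" using \<open>eta \<le> c * eta\<close> by simp
    show "0 < lam - 2 * c * eta" using lam_c by simp
  qed
  finally show ?thesis by (simp add: c_def eta_def Delta_def mult_ac)
qed

end
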